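(* Let $M$ be an $n$-dimensional manifold, $n>2$, $(g,\xi:=grad(f),\lambda,\mu)$ a gradient $\eta$-Ricci soliton on $M$ with $\eta=df$ the $g$-dual $1$-form of $\xi$, and $\gamma$ a $1$-form on $M$. Then $$\tfrac12\Delta(\langle df,\gamma\rangle)=\langle Hess(f),\nabla\gamma\rangle-\mu\,\Delta(f)\langle df,\gamma\rangle+\tfrac12\langle df,\Delta(\gamma)\rangle.$$
   Context: $g$ is a Riemannian metric on $M$, $f\in C^\infty(M)$, $\nabla$ the Levi-Civita connection, $S$ the Ricci tensor. The gradient $\eta$-Ricci soliton condition is $L_{\xi}g+2S+2\lambda g+2\mu\,\eta\otimes\eta=0$ with $\xi=grad(f)$, $\eta=df$ (equivalently $Hess(f)+S+\lambda g+\mu\,df\otimes df=0$), $\lambda,\mu$ real constants. $\Delta$ is the Laplace-Hodge operator on forms with the sign for which $\Delta(u)=div(grad(u))$ on functions and $\Delta(du)=d(\Delta(u))$, i.e. $\Delta=-(d\delta+\delta d)$. $\langle\gamma_1,\gamma_2\rangle=\sum_i\gamma_1(E_i)\gamma_2(E_i)$ for $1$-forms and $\langle T_1,T_2\rangle=\sum_{i,j}T_1(E_i,E_j)T_2(E_i,E_j)$ for $(0,2)$-tensor fields, with $\{E_i\}$ a local orthonormal frame. *)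

theory Defs
  imports "HOL-Analysis.Analysis"
begin

section \<open>Smooth manifolds\<close>

fun times_differentiable_on ::
  "nat \<Rightarrow> ('a::real_normed_vector \<Rightarrow> 'b::real_normed_vector) \<Rightarrow> 'a set \<Rightarrow> bool" where
  "times_differentiable_on 0 f S \<longleftrightarrow> continuous_on S f"
| "times_differentiable_on (Suc k) f S \<longleftrightarrow>
     (\<forall>x\<in>S. f differentiable (at x)) \<and>
     (\<forall>v. times_differentiable_on k (\<lambda>x. frechet_derivative f (at x) v) S)"

text \<open>\<open>C\<^sup>\<infinity>\<close> on an open subset of a finite-dimensional space.\<close>

definition smooth_on ::
  "('a::euclidean_space \<Rightarrow> 'b::real_normed_vector) \<Rightarrow> 'a set \<Rightarrow> bool" where
  "smooth_on f S \<longleftrightarrow> open S \<and> (\<forall>k. times_differentiable_on k f S)"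

text \<open>The dimension is \<open>CARD('n)\<close>. A chart is a pair of its domain and its coordinate map.
  The charts form an atlas, not necessarily a maximal one.\<close>

record ('a, 'n::finite) manifold =
  mtop :: "'a topology"
  charts :: "('a set \<times> ('a \<Rightarrow> real ^ 'n)) set"

definition smooth_manifold :: "('a, 'n::finite) manifold \<Rightarrow> bool" where
  "smooth_manifold M \<longleftrightarrow>
     Hausdorff_space (mtop M) \<and> second_countable (mtop M) \<and>
     (\<Union>(V, \<phi>)\<in>charts M. V) = topspace (mtop M) \<and>
     (\<forall>(V, \<phi>)\<in>charts M. openin (mtop M) V \<and> open (\<phi> ` V) \<and>
        homeomorphic_map (subtopology (mtop M) V) (top_of_set (\<phi> ` V)) \<phi>) \<and>
     (\<forall>(V, \<phi>)\<in>charts M. \<forall>(W, \<psi>)\<in>charts M.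
        smooth_on (\<psi> \<circ> inv_into V \<phi>) (\<phi> ` (V \<inter> W)))"

text \<open>Functions on an open set \<open>U\<close>, and below vector fields on \<open>U\<close>, are total functions whose
  values outside \<open>U\<close> are arbitrary.\<close>

definition smooth_fun :: "('a, 'n::finite) manifold \<Rightarrow> 'a set \<Rightarrow> ('a \<Rightarrow> real) \<Rightarrow> bool" where
  "smooth_fun M U u \<longleftrightarrow> openin (mtop M) U \<and>
     (\<forall>(V, \<phi>)\<in>charts M. smooth_on (u \<circ> inv_into V \<phi>) (\<phi> ` (U \<inter> V)))"

definition smooth_near :: "('a, 'n::finite) manifold \<Rightarrow> 'a \<Rightarrow> ('a \<Rightarrow> real) \<Rightarrow> bool" where
  "smooth_near M p u \<longleftrightarrow> (\<exists>U. p \<in> U \<and> smooth_fun M U u)"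


section \<open>Tangent vectors and vector fields\<close>

text \<open>A tangent vector at \<open>p\<close> is the derivative, along a smooth curve through \<open>p\<close>, of functions
  which are smooth near \<open>p\<close>. It takes the value 0 on all other functions, so that equality of
  tangent vectors is equality of HOL functions. The linear operations on tangent vectors are
  pointwise.\<close>

type_synonym 'a tvec = "('a \<Rightarrow> real) \<Rightarrow> real"
type_synonym 'a vfield = "'a \<Rightarrow> 'a tvec"

definition smooth_curve :: "('a, 'n::finite) manifold \<Rightarrow> (real \<Rightarrow> 'a) \<Rightarrow> bool" where
  "smooth_curve M c \<longleftrightarrow> (\<exists>e>0.
     continuous_map (top_of_set {-e<..<e}) (mtop M) c \<and>
     (\<forall>(V, \<phi>)\<in>charts M. smooth_on (\<phi> \<circ> c) {t \<in> {-e<..<e}. c t \<in> V}))"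

definition velocity :: "('a, 'n::finite) manifold \<Rightarrow> (real \<Rightarrow> 'a) \<Rightarrow> 'a tvec" where
  "velocity M c = (\<lambda>u. if smooth_near M (c 0) u then deriv (\<lambda>t. u (c t)) 0 else 0)"

definition tangent_space :: "('a, 'n::finite) manifold \<Rightarrow> 'a \<Rightarrow> 'a tvec set" where
  "tangent_space M p = {velocity M c | c. smooth_curve M c \<and> c 0 = p}"

definition vector_fields :: "('a, 'n::finite) manifold \<Rightarrow> 'a set \<Rightarrow> 'a vfield set" where
  "vector_fields M U = {X. (\<forall>p\<in>U. X p \<in> tangent_space M p) \<and>
     (\<forall>V u. V \<subseteq> U \<and> smooth_fun M V u \<longrightarrow> smooth_fun M V (\<lambda>p. X p u))}"

definition lin_comb ::
  "('a \<Rightarrow> real) \<Rightarrow> 'a vfield \<Rightarrow> ('a \<Rightarrow> real) \<Rightarrow> 'a vfield \<Rightarrow> 'a vfield" where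
  "lin_comb a X b Y = (\<lambda>p u. a p * X p u + b p * Y p u)"

definition lie_bracket ::
  "('a, 'n::finite) manifold \<Rightarrow> 'a vfield \<Rightarrow> 'a vfield \<Rightarrow> 'a vfield" where
  "lie_bracket M X Y = (\<lambda>p u.
     if smooth_near M p u then X p (\<lambda>q. Y q u) - Y p (\<lambda>q. X q u) else 0)"


section \<open>Metric, Levi-Civita connection, curvature\<close>

type_synonym 'a metric = "'a \<Rightarrow> 'a tvec \<Rightarrow> 'a tvec \<Rightarrow> real"
type_synonym 'a connection = "'a vfield \<Rightarrow> 'a vfield \<Rightarrow> 'a vfield"

definition riemannian_metric :: "('a, 'n::finite) manifold \<Rightarrow> 'a metric \<Rightarrow> bool" where
  "riemannian_metric M g \<longleftrightarrow>
     (\<forall>p\<in>topspace (mtop M).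
        (\<forall>v\<in>tangent_space M p. \<forall>w\<in>tangent_space M p. \<forall>z\<in>tangent_space M p. \<forall>a b.
           g p (\<lambda>u. a * v u + b * w u) z = a * g p v z + b * g p w z) \<and>
        (\<forall>v\<in>tangent_space M p. \<forall>w\<in>tangent_space M p. g p v w = g p w v) \<and>
        (\<forall>v\<in>tangent_space M p. v \<noteq> (\<lambda>u. 0) \<longrightarrow> g p v v > 0)) \<and>
     (\<forall>U. openin (mtop M) U \<longrightarrow>
        (\<forall>X\<in>vector_fields M U. \<forall>Y\<in>vector_fields M U.
           smooth_fun M U (\<lambda>p. g p (X p) (Y p))))"

text \<open>An affine connection, given together with its restrictions to the open subsets: one operator
  acts on the vector fields on every open \<open>U\<close>, and its values on \<open>U\<close> depend only on the arguments
  on \<open>U\<close>. Since connections are local, this is the same datum as a connection on the global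
  vector fields.\<close>

definition affine_connection :: "('a, 'n::finite) manifold \<Rightarrow> 'a connection \<Rightarrow> bool" where
  "affine_connection M D \<longleftrightarrow> (\<forall>U. openin (mtop M) U \<longrightarrow>
     (\<forall>X\<in>vector_fields M U. \<forall>Y\<in>vector_fields M U. D X Y \<in> vector_fields M U) \<and>
     (\<forall>X\<in>vector_fields M U. \<forall>Y\<in>vector_fields M U.
      \<forall>X'\<in>vector_fields M U. \<forall>Y'\<in>vector_fields M U.
        (\<forall>p\<in>U. X p = X' p \<and> Y p = Y' p) \<longrightarrow> (\<forall>p\<in>U. D X Y p = D X' Y' p)) \<and>
     (\<forall>X\<in>vector_fields M U. \<forall>Y\<in>vector_fields M U. \<forall>Z\<in>vector_fields M U.
      \<forall>a b. smooth_fun M U a \<and> smooth_fun M U b \<longrightarrow>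
        (\<forall>p\<in>U. D (lin_comb a X b Y) Z p = lin_comb a (D X Z) b (D Y Z) p)) \<and>
     (\<forall>X\<in>vector_fields M U. \<forall>Y\<in>vector_fields M U. \<forall>Z\<in>vector_fields M U.
        \<forall>p\<in>U. D X (\<lambda>q u. Y q u + Z q u) p = (\<lambda>u. D X Y p u + D X Z p u)) \<and>
     (\<forall>X\<in>vector_fields M U. \<forall>Y\<in>vector_fields M U. \<forall>a. smooth_fun M U a \<longrightarrow>
        (\<forall>p\<in>U. D X (\<lambda>q u. a q * Y q u) p = (\<lambda>u. a p * D X Y p u + X p a * Y p u))))"

definition torsion_free :: "('a, 'n::finite) manifold \<Rightarrow> 'a connection \<Rightarrow> bool" where
  "torsion_free M D \<longleftrightarrow> (\<forall>U. openin (mtop M) U \<longrightarrow>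
     (\<forall>X\<in>vector_fields M U. \<forall>Y\<in>vector_fields M U.
        \<forall>p\<in>U. (\<lambda>u. D X Y p u - D Y X p u) = lie_bracket M X Y p))"

definition metric_compatible ::
  "('a, 'n::finite) manifold \<Rightarrow> 'a metric \<Rightarrow> 'a connection \<Rightarrow> bool" where
  "metric_compatible M g D \<longleftrightarrow> (\<forall>U. openin (mtop M) U \<longrightarrow>
     (\<forall>X\<in>vector_fields M U. \<forall>Y\<in>vector_fields M U. \<forall>Z\<in>vector_fields M U.
        \<forall>p\<in>U. X p (\<lambda>q. g q (Y q) (Z q)) = g p (D X Y p) (Z p) + g p (Y p) (D X Z p)))"

definition levi_civita_connection ::
  "('a, 'n::finite) manifold \<Rightarrow> 'a metric \<Rightarrow> 'a connection \<Rightarrow> bool" where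
  "levi_civita_connection M g D \<longleftrightarrow>
     affine_connection M D \<and> torsion_free M D \<and> metric_compatible M g D"

definition orthonormal_frame ::
  "('a, 'n::finite) manifold \<Rightarrow> 'a metric \<Rightarrow> 'a set \<Rightarrow> ('n \<Rightarrow> 'a vfield) \<Rightarrow> bool" where
  "orthonormal_frame M g U E \<longleftrightarrow> (\<forall>i. E i \<in> vector_fields M U) \<and>
     (\<forall>p\<in>U. \<forall>i j. g p (E i p) (E j p) = (if i = j then 1 else 0))"

text \<open>Some local orthonormal frame around \<open>p\<close>; the contractions below do not depend on the
  choice.\<close>

definition frame_at :: "('a, 'n::finite) manifold \<Rightarrow> 'a metric \<Rightarrow> 'a \<Rightarrow> 'n \<Rightarrow> 'a vfield" where
  "frame_at M g p = (SOME E. \<exists>U. openin (mtop M) U \<and> p \<in> U \<and> orthonormal_frame M g U E)"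

definition curvature ::
  "('a, 'n::finite) manifold \<Rightarrow> 'a connection \<Rightarrow> 'a vfield \<Rightarrow> 'a vfield \<Rightarrow> 'a vfield \<Rightarrow> 'a vfield"
  where
  "curvature M D X Y Z = (\<lambda>p u. D X (D Y Z) p u - D Y (D X Z) p u - D (lie_bracket M X Y) Z p u)"


section \<open>Covariant tensor fields and differential operators\<close>

text \<open>Covariant tensor fields act on vector fields: for \<open>X\<close>, \<open>Y\<close> defined on an open \<open>U\<close>, the values
  of \<open>T X Y\<close> are meaningful at the points of \<open>U\<close>.\<close>

type_synonym 'a tensor1 = "'a vfield \<Rightarrow> 'a \<Rightarrow> real"
type_synonym 'a tensor2 = "'a vfield \<Rightarrow> 'a vfield \<Rightarrow> 'a \<Rightarrow> real"

text \<open>Smooth 1-forms as \<open>C\<^sup>\<infinity>\<close>-linear maps on vector fields. As the linearity condition is stated for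
  all \<open>Z\<close> that agree with \<open>a X + b Y\<close> on \<open>U\<close>, it also says that the values on \<open>U\<close> depend only on
  the argument on \<open>U\<close>.\<close>

definition one_form :: "('a, 'n::finite) manifold \<Rightarrow> 'a tensor1 \<Rightarrow> bool" where
  "one_form M \<gamma> \<longleftrightarrow> (\<forall>U. openin (mtop M) U \<longrightarrow>
     (\<forall>X\<in>vector_fields M U. smooth_fun M U (\<gamma> X)) \<and>
     (\<forall>X\<in>vector_fields M U. \<forall>Y\<in>vector_fields M U. \<forall>Z\<in>vector_fields M U.
      \<forall>a b. smooth_fun M U a \<and> smooth_fun M U b \<and> (\<forall>p\<in>U. Z p = lin_comb a X b Y p) \<longrightarrow>
        (\<forall>p\<in>U. \<gamma> Z p = a p * \<gamma> X p + b p * \<gamma> Y p)))"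

definition differential :: "('a \<Rightarrow> real) \<Rightarrow> 'a tensor1" where
  "differential u X p = X p u"

definition grad :: "('a, 'n::finite) manifold \<Rightarrow> 'a metric \<Rightarrow> ('a \<Rightarrow> real) \<Rightarrow> 'a vfield" where
  "grad M g u p = (THE v. v \<in> tangent_space M p \<and> (\<forall>w\<in>tangent_space M p. g p v w = w u))"

definition inner1 ::
  "('a, 'n::finite) manifold \<Rightarrow> 'a metric \<Rightarrow> 'a tensor1 \<Rightarrow> 'a tensor1 \<Rightarrow> 'a \<Rightarrow> real" where
  "inner1 M g \<alpha> \<beta> p = (let E = frame_at M g p in \<Sum>i\<in>UNIV. \<alpha> (E i) p * \<beta> (E i) p)"

definition inner2 ::
  "('a, 'n::finite) manifold \<Rightarrow> 'a metric \<Rightarrow> 'a tensor2 \<Rightarrow> 'a tensor2 \<Rightarrow> 'a \<Rightarrow> real" where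
  "inner2 M g S T p = (let E = frame_at M g p in
     \<Sum>i\<in>UNIV. \<Sum>j\<in>UNIV. S (E i) (E j) p * T (E i) (E j) p)"

text \<open>\<open>S(Y, Z)\<close> is the trace of \<open>X \<mapsto> R(X, Y) Z\<close>, positive on round spheres.\<close>

definition ricci ::
  "('a, 'n::finite) manifold \<Rightarrow> 'a metric \<Rightarrow> 'a connection \<Rightarrow> 'a tensor2" where
  "ricci M g D Y Z p = (let E = frame_at M g p in
     \<Sum>i\<in>UNIV. g p (curvature M D (E i) Y Z p) (E i p))"

definition lie_derivative_metric ::
  "('a, 'n::finite) manifold \<Rightarrow> 'a metric \<Rightarrow> 'a vfield \<Rightarrow> 'a tensor2" where
  "lie_derivative_metric M g X Y Z p =
     X p (\<lambda>q. g q (Y q) (Z q))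
     - g p (lie_bracket M X Y p) (Z p) - g p (Y p) (lie_bracket M X Z p)"

text \<open>\<open>(\<nabla>\<gamma>)(X, Y) = (\<nabla>\<^sub>X \<gamma>)(Y)\<close> and \<open>(\<nabla>\<beta>)(X, Y, Z) = (\<nabla>\<^sub>X \<beta>)(Y, Z)\<close>.\<close>

definition cov_deriv1 :: "'a connection \<Rightarrow> 'a tensor1 \<Rightarrow> 'a tensor2" where
  "cov_deriv1 D \<gamma> X Y p = X p (\<gamma> Y) - \<gamma> (D X Y) p"

definition cov_deriv2 ::
  "'a connection \<Rightarrow> 'a tensor2 \<Rightarrow> 'a vfield \<Rightarrow> 'a vfield \<Rightarrow> 'a vfield \<Rightarrow> 'a \<Rightarrow> real" where
  "cov_deriv2 D \<beta> X Y Z p = X p (\<beta> Y Z) - \<beta> (D X Y) Z p - \<beta> Y (D X Z) p"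

definition Hess :: "'a connection \<Rightarrow> ('a \<Rightarrow> real) \<Rightarrow> 'a tensor2" where
  "Hess D u = cov_deriv1 D (differential u)"

definition ext_deriv1 :: "('a, 'n::finite) manifold \<Rightarrow> 'a tensor1 \<Rightarrow> 'a tensor2" where
  "ext_deriv1 M \<gamma> X Y p = X p (\<gamma> Y) - Y p (\<gamma> X) - \<gamma> (lie_bracket M X Y) p"

definition codiff1 ::
  "('a, 'n::finite) manifold \<Rightarrow> 'a metric \<Rightarrow> 'a connection \<Rightarrow> 'a tensor1 \<Rightarrow> 'a \<Rightarrow> real" where
  "codiff1 M g D \<gamma> p = (let E = frame_at M g p in - (\<Sum>i\<in>UNIV. cov_deriv1 D \<gamma> (E i) (E i) p))"

definition codiff2 ::
  "('a, 'n::finite) manifold \<Rightarrow> 'a metric \<Rightarrow> 'a connection \<Rightarrow> 'a tensor2 \<Rightarrow> 'a tensor1" where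
  "codiff2 M g D \<beta> Y p = (let E = frame_at M g p in
     - (\<Sum>i\<in>UNIV. cov_deriv2 D \<beta> (E i) (E i) Y p))"

text \<open>\<open>\<Delta> = -(d \<delta> + \<delta> d)\<close>, where \<open>\<delta>\<close> vanishes on functions, so \<open>\<Delta> u = -\<delta> d u = div (grad u)\<close>.\<close>

definition laplace_fun ::
  "('a, 'n::finite) manifold \<Rightarrow> 'a metric \<Rightarrow> 'a connection \<Rightarrow> ('a \<Rightarrow> real) \<Rightarrow> 'a \<Rightarrow> real" where
  "laplace_fun M g D u p = - codiff1 M g D (differential u) p"

definition laplace_form ::
  "('a, 'n::finite) manifold \<Rightarrow> 'a metric \<Rightarrow> 'a connection \<Rightarrow> 'a tensor1 \<Rightarrow> 'a tensor1" where
  "laplace_form M g D \<gamma> X p =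
     - (differential (codiff1 M g D \<gamma>) X p + codiff2 M g D (ext_deriv1 M \<gamma>) X p)"


section \<open>Eta-Ricci solitons\<close>

definition eta_ricci_soliton ::
  "('a, 'n::finite) manifold \<Rightarrow> 'a metric \<Rightarrow> 'a connection \<Rightarrow> 'a vfield \<Rightarrow> 'a tensor1 \<Rightarrow>
   real \<Rightarrow> real \<Rightarrow> bool" where
  "eta_ricci_soliton M g D \<xi> \<eta> lam \<mu> \<longleftrightarrow> (\<forall>U. openin (mtop M) U \<longrightarrow>
     (\<forall>X\<in>vector_fields M U. \<forall>Y\<in>vector_fields M U. \<forall>p\<in>U.
        lie_derivative_metric M g \<xi> X Y p + 2 * ricci M g D X Y p
        + 2 * lam * g p (X p) (Y p) + 2 * \<mu> * (\<eta> X p * \<eta> Y p) = 0))"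

definition gradient_eta_ricci_soliton ::
  "('a, 'n::finite) manifold \<Rightarrow> 'a metric \<Rightarrow> 'a connection \<Rightarrow> ('a \<Rightarrow> real) \<Rightarrow> real \<Rightarrow> real \<Rightarrow> bool"
  where
  "gradient_eta_ricci_soliton M g D f lam \<mu> \<longleftrightarrow>
     smooth_fun M (topspace (mtop M)) f \<and>
     eta_ricci_soliton M g D (grad M g f) (differential f) lam \<mu>"

end

theory Submission
  imports Defs
begin

text \<open>Let \<open>G\<close> be the vector field dual to \<open>\<gamma>\<close> and \<open>\<xi> = grad f\<close>, so that \<open>\<langle>df, \<gamma>\<rangle> = g(G, \<xi>)\<close>. The product
  rule gives \<open>\<Delta> g(G, \<xi>) = g(tr \<nabla>\<^sup>2 G, \<xi>) + 2 \<langle>Hess f, \<nabla>\<gamma>\<rangle> + g(tr \<nabla>\<^sup>2 \<xi>, G)\<close>, and the Weitzenboeck formula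
  turns the first term into \<open>\<langle>df, \<Delta>\<gamma>\<rangle> + S(\<xi>, G)\<close>. It remains to see that
  \<open>g(tr \<nabla>\<^sup>2 \<xi>, G) + S(\<xi>, G) + 2 \<mu> \<Delta>f g(\<xi>, G) = 0\<close>. The equation \<open>Hess f + S + \<lambda> g + \<mu> df \<otimes> df = 0\<close> has a
  divergence and a trace. Half of the differential of the trace is subtracted from the divergence:
  the Ricci terms cancel by the contracted second Bianchi identity, and commuting covariant
  derivatives in the Hessian leaves half of the claimed equation.\<close>

section \<open>Calculus on open sets\<close>

text \<open>The contractions \<open>inner1\<close>, \<open>ricci\<close> and \<open>codiff1\<close>
  use at every point a frame chosen for that point alone. Nothing relates the frames at neighbouring
  points, so a contraction cannot be differentiated as it stands. \<open>trace_frame_indep\<close>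
  and \<open>parseval\<close> rewrite it near a point in terms of one fixed frame or without any
  frame, and \<open>trace_deriv_zero\<close> shows that the derivatives of a fixed frame do not
  contribute to the derivative of a trace; together they take the place of normal coordinates. As
  tensors here are functions of vector fields, a contracted expression has to be shown
  function-linear in each slot (\<open>tensorial\<close>) before it can be expanded in a frame. The
  coefficient 2 \<mu> arises as follows. The divergence of \<mu> df \<otimes> df is \<mu> (\<Delta>f
  df + Hess f (\<xi>, -)), half of the differential of its trace is \<mu> Hess f (\<xi>, -), so the
  difference is \<mu> \<Delta>f df; the identity is then doubled. In the same difference, commuting
  derivatives leaves div (Hess f) - 1/2 d(\<Delta>f), which is half of the trace of
  \<nabla>\<nabla>\<xi> plus half of the Ricci term.\<close>

lemma times_differentiable_on_cong:
  assumes "open S" "\<And>x. x \<in> S \<Longrightarrow> f x = h x"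
  shows "times_differentiable_on k f S \<longleftrightarrow> times_differentiable_on k h S"
  using assms(2)
proof (induction k arbitrary: f h)
  case 0
  then show ?case by (simp cong: continuous_on_cong)
next
  case (Suc k)
  have d: "f differentiable (at x) \<longleftrightarrow> h differentiable (at x)" if "x \<in> S" for x
    using has_derivative_transform_within_open[OF _ \<open>open S\<close> that] Suc.prems
    unfolding differentiable_def by metis
  have e: "frechet_derivative f (at x) = frechet_derivative h (at x)" if "x \<in> S" for x
  proof (cases "f differentiable (at x)")
    case True
    then show ?thesis
      using frechet_derivative_transform_within_open[OF True \<open>open S\<close> that] Suc.prems by auto
  next
    \<comment> \<open>Without a derivative both sides are a \<open>SOME\<close> over the same
      unsatisfiable predicate, so even these default values agree.\<close>
    case False
    then show ?thesis using d[OF that]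
      unfolding frechet_derivative_def differentiable_def by auto
  qed
  have "times_differentiable_on k (\<lambda>x. frechet_derivative f (at x) v) S \<longleftrightarrow>
     times_differentiable_on k (\<lambda>x. frechet_derivative h (at x) v) S" for v
    by (rule Suc.IH) (simp add: e)
  then show ?case using d by simp
qed

lemma times_differentiable_on_subset:
  "times_differentiable_on k f S \<Longrightarrow> T \<subseteq> S \<Longrightarrow> times_differentiable_on k f T"
  by (induction k arbitrary: f) (auto intro: continuous_on_subset)

lemma times_differentiable_on_Suc_imp:
  "times_differentiable_on (Suc k) f S \<Longrightarrow> times_differentiable_on k f S"
proof (induction k arbitrary: f)
  case 0
  then show ?case
    by (auto intro!: continuous_at_imp_continuous_on differentiable_imp_continuous_within)
next
  case (Suc k)
  then show ?case by (metis times_differentiable_on.simps(2))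
qed

lemma times_differentiable_on_const: "times_differentiable_on k (\<lambda>x. c) S"
  by (induction k arbitrary: c) auto

lemma times_differentiable_on_bounded_linear_comp:
  assumes "bounded_linear L" "open S"
  shows "times_differentiable_on k f S \<Longrightarrow> times_differentiable_on k (\<lambda>x. L (f x)) S"
proof (induction k arbitrary: f)
  case 0
  then show ?case
    using assms by (simp add: bounded_linear.continuous_on)
next
  case (Suc k)
  have d: "((\<lambda>x. L (f x)) has_derivative (\<lambda>v. L (frechet_derivative f (at x) v))) (at x)"
    if "x \<in> S" for x
    using Suc.prems that
    by (intro bounded_linear.has_derivative[OF assms(1)]) (simp add: frechet_derivative_works[THEN iffD1])
  have "times_differentiable_on k (\<lambda>x. frechet_derivative (\<lambda>x. L (f x)) (at x) v) S" for v
  proof (subst times_differentiable_on_cong[OF assms(2)])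
    show "frechet_derivative (\<lambda>x. L (f x)) (at x) v = L (frechet_derivative f (at x) v)"
      if "x \<in> S" for x
      using frechet_derivative_at[OF d[OF that]] by metis
    show "times_differentiable_on k (\<lambda>x. L (frechet_derivative f (at x) v)) S"
      using Suc by auto
  qed
  then show ?case using d by (auto simp: differentiable_def)
qed

lemma times_differentiable_on_add:
  assumes "open S"
  shows "times_differentiable_on k f S \<Longrightarrow> times_differentiable_on k h S \<Longrightarrow>
    times_differentiable_on k (\<lambda>x. f x + h x) S"
proof (induction k arbitrary: f h)
  case 0
  then show ?case by (simp add: continuous_on_add)
next
  case (Suc k)
  have d: "((\<lambda>x. f x + h x) has_derivative
      (\<lambda>v. frechet_derivative f (at x) v + frechet_derivative h (at x) v)) (at x)"
    if "x \<in> S" for x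
    using Suc.prems that by (intro has_derivative_add) (simp_all add: frechet_derivative_works[THEN iffD1])
  have "times_differentiable_on k (\<lambda>x. frechet_derivative (\<lambda>x. f x + h x) (at x) v) S" for v
  proof (subst times_differentiable_on_cong[OF assms(1)])
    show "frechet_derivative (\<lambda>x. f x + h x) (at x) v =
        frechet_derivative f (at x) v + frechet_derivative h (at x) v"
      if "x \<in> S" for x
      using frechet_derivative_at[OF d[OF that]] by metis
    show "times_differentiable_on k
        (\<lambda>x. frechet_derivative f (at x) v + frechet_derivative h (at x) v) S"
      using Suc by auto
  qed
  then show ?case using d by (auto simp: differentiable_def)
qed

lemma times_differentiable_on_sum:
  assumes "open S" "finite I" "\<And>i. i \<in> I \<Longrightarrow> times_differentiable_on k (f i) S"
  shows "times_differentiable_on k (\<lambda>x. \<Sum>i\<in>I. f i x) S"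
  using assms(2,3)
  by (induction I rule: finite_induct)
    (auto intro: times_differentiable_on_add[OF assms(1)] times_differentiable_on_const)

text \<open>Scalar multiplication instead of a product of reals, since the chain rule below needs
  real coefficients times values in a normed space. The product rule keeps one factor
  undifferentiated, hence the use of \<open>times_differentiable_on_Suc_imp\<close>.\<close>

lemma times_differentiable_on_scaleR:
  assumes "open S"
  shows "times_differentiable_on k f S \<Longrightarrow> times_differentiable_on k h S \<Longrightarrow>
    times_differentiable_on k (\<lambda>x. f x *\<^sub>R h x) S"
proof (induction k arbitrary: f h)
  case 0
  then show ?case by (simp add: continuous_on_scaleR)
next
  case (Suc k)
  have d: "((\<lambda>x. f x *\<^sub>R h x) has_derivative
      (\<lambda>v. f x *\<^sub>R frechet_derivative h (at x) v + frechet_derivative f (at x) v *\<^sub>R h x)) (at x)"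
    if "x \<in> S" for x
    using Suc.prems that by (intro has_derivative_scaleR) (simp_all add: frechet_derivative_works[THEN iffD1])
  have "times_differentiable_on k (\<lambda>x. frechet_derivative (\<lambda>x. f x *\<^sub>R h x) (at x) v) S" for v
  proof (subst times_differentiable_on_cong[OF assms(1)])
    show "frechet_derivative (\<lambda>x. f x *\<^sub>R h x) (at x) v =
        f x *\<^sub>R frechet_derivative h (at x) v + frechet_derivative f (at x) v *\<^sub>R h x"
      if "x \<in> S" for x
      using frechet_derivative_at[OF d[OF that]] by metis
    show "times_differentiable_on k
        (\<lambda>x. f x *\<^sub>R frechet_derivative h (at x) v + frechet_derivative f (at x) v *\<^sub>R h x) S"
      using Suc.prems Suc.prems[THEN times_differentiable_on_Suc_imp]
      by (intro times_differentiable_on_add[OF assms] Suc.IH) auto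
  qed
  then show ?case using d by (auto simp: differentiable_def)
qed

text \<open>The derivative of \<open>f \<circ> h\<close> is a derivative of \<open>f\<close> in a
  direction that moves with the point, while \<open>times_differentiable_on\<close> speaks of fixed
  directions only. Expanding the moving direction over \<open>Basis\<close> gives sums of products
  with fixed directional derivatives of \<open>f\<close>, to which the induction hypothesis
  applies.\<close>

lemma times_differentiable_on_compose:
  fixes f :: "'b::euclidean_space \<Rightarrow> 'c::real_normed_vector"
    and h :: "'a::real_normed_vector \<Rightarrow> 'b"
  assumes "open S" "h ` S \<subseteq> T"
  shows "times_differentiable_on k f T \<Longrightarrow> times_differentiable_on k h S \<Longrightarrow>
    times_differentiable_on k (f \<circ> h) S"
proof (induction k arbitrary: f)
  case 0
  then have "continuous_on S h" "continuous_on (h ` S) f"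
    using assms(2) continuous_on_subset by auto
  then show ?case by (simp only: times_differentiable_on.simps continuous_on_compose)
next
  case (Suc k)
  have d: "((f \<circ> h) has_derivative
      (\<lambda>v. frechet_derivative f (at (h x)) (frechet_derivative h (at x) v))) (at x)"
    and l: "linear (frechet_derivative f (at (h x)))"
    if "x \<in> S" for x
  proof -
    have "h x \<in> T" using assms(2) that by auto
    then have "(f has_derivative frechet_derivative f (at (h x))) (at (h x))"
      "(h has_derivative frechet_derivative h (at x)) (at x)"
      using Suc.prems that by (simp_all add: frechet_derivative_works[THEN iffD1])
    from diff_chain_at[OF this(2,1)] has_derivative_linear[OF this(1)]
    show "((f \<circ> h) has_derivative
      (\<lambda>v. frechet_derivative f (at (h x)) (frechet_derivative h (at x) v))) (at x)"
      "linear (frechet_derivative f (at (h x)))"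
      by (simp_all add: o_def)
  qed
  have "times_differentiable_on k (\<lambda>x. frechet_derivative (f \<circ> h) (at x) v) S" for v
  proof (subst times_differentiable_on_cong[OF assms(1)])
    show "frechet_derivative (f \<circ> h) (at x) v =
        (\<Sum>b\<in>Basis. (frechet_derivative h (at x) v \<bullet> b) *\<^sub>R frechet_derivative f (at (h x)) b)"
      if "x \<in> S" for x
    proof -
      let ?w = "frechet_derivative h (at x) v"
      have "frechet_derivative (f \<circ> h) (at x) v = frechet_derivative f (at (h x)) ?w"
        using frechet_derivative_at[OF d[OF that]] by metis
      also have "\<dots> = frechet_derivative f (at (h x)) (\<Sum>b\<in>Basis. (?w \<bullet> b) *\<^sub>R b)"
        by (simp only: euclidean_representation)
      also have "\<dots> = (\<Sum>b\<in>Basis. (?w \<bullet> b) *\<^sub>R frechet_derivative f (at (h x)) b)"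
        using l[OF that] by (simp only: linear_sum linear_cmul)
      finally show ?thesis .
    qed
    have "times_differentiable_on k (\<lambda>x. frechet_derivative f (at (h x)) b) S" for b
      using Suc.IH[of "\<lambda>y. frechet_derivative f (at y) b"] Suc.prems
        times_differentiable_on_Suc_imp[OF Suc.prems(2)] by (simp add: o_def)
    moreover have "times_differentiable_on k (\<lambda>x. frechet_derivative h (at x) v \<bullet> b) S" for b
      using Suc.prems
      by (intro times_differentiable_on_bounded_linear_comp[OF bounded_linear_inner_left assms(1)])
        simp
    ultimately show "times_differentiable_on k (\<lambda>x.
      \<Sum>b\<in>Basis. (frechet_derivative h (at x) v \<bullet> b) *\<^sub>R frechet_derivative f (at (h x)) b) S"
      by (intro times_differentiable_on_sum[OF assms(1)] times_differentiable_on_scaleR[OF assms(1)])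
        auto
  qed
  then show ?case using d unfolding times_differentiable_on.simps differentiable_def by blast
qed

text \<open>The exponent is arbitrary in the induction because differentiation lowers it. The
  exponent -1/2 is the one that normalises a vector in the Gram-Schmidt process.\<close>

lemma times_differentiable_on_powr:
  "times_differentiable_on k (\<lambda>x::real. x powr a) {0<..}"
proof (induction k arbitrary: a)
  case 0
  then show ?case by (auto intro!: continuous_intros)
next
  case (Suc k)
  have d: "((\<lambda>x. x powr a) has_derivative (\<lambda>v. (v * a) *\<^sub>R x powr (a - 1))) (at x)"
    if "x \<in> {0<..}" for x
  proof -
    have "((\<lambda>x. x powr a) has_real_derivative a * x powr (a - 1)) (at x)"
      using that by (intro has_real_derivative_powr) auto
    then show ?thesis
      unfolding has_field_derivative_def by (rule has_derivative_eq_rhs) auto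
  qed
  have "times_differentiable_on k (\<lambda>x. frechet_derivative (\<lambda>x. x powr a) (at x) v) {0<..}" for v
  proof (subst times_differentiable_on_cong)
    show "frechet_derivative (\<lambda>x. x powr a) (at x) v = (v * a) *\<^sub>R x powr (a - 1)"
      if "x \<in> {0<..}" for x :: real
      using frechet_derivative_at[OF d[OF that]] by metis
    show "times_differentiable_on k (\<lambda>x. (v * a) *\<^sub>R x powr (a - 1)) {0<..}"
      by (intro times_differentiable_on_scaleR times_differentiable_on_const Suc) auto
  qed auto
  then show ?case using d by (auto simp: differentiable_def)
qed

lemma smooth_on_cong:
  "(\<And>x. x \<in> S \<Longrightarrow> f x = h x) \<Longrightarrow> smooth_on f S \<longleftrightarrow> smooth_on h S"
  unfolding smooth_on_def using times_differentiable_on_cong by blast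

lemma smooth_on_subset: "smooth_on f S \<Longrightarrow> T \<subseteq> S \<Longrightarrow> open T \<Longrightarrow> smooth_on f T"
  unfolding smooth_on_def using times_differentiable_on_subset by blast

lemma smooth_on_const: "open S \<Longrightarrow> smooth_on (\<lambda>x. c) S"
  unfolding smooth_on_def using times_differentiable_on_const by blast

lemma smooth_on_add: "smooth_on f S \<Longrightarrow> smooth_on h S \<Longrightarrow> smooth_on (\<lambda>x. f x + h x) S"
  unfolding smooth_on_def using times_differentiable_on_add by blast

lemma smooth_on_mult:
  fixes f h :: "_ \<Rightarrow> real"
  shows "smooth_on f S \<Longrightarrow> smooth_on h S \<Longrightarrow> smooth_on (\<lambda>x. f x * h x) S"
  unfolding smooth_on_def using times_differentiable_on_scaleR[where f=f and h=h] by auto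

lemma smooth_on_compose:
  "smooth_on f T \<Longrightarrow> smooth_on h S \<Longrightarrow> h ` S \<subseteq> T \<Longrightarrow> smooth_on (f \<circ> h) S"
  unfolding smooth_on_def using times_differentiable_on_compose by blast

lemma smooth_on_powr: "smooth_on f S \<Longrightarrow> (\<And>x. x \<in> S \<Longrightarrow> f x > 0) \<Longrightarrow> smooth_on (\<lambda>x. f x powr a :: real) S"
  using smooth_on_compose[of "\<lambda>x::real. x powr a" "{0<..}" f S] times_differentiable_on_powr
  by (auto simp: smooth_on_def o_def image_subset_iff)

lemma smooth_on_frechet_derivative:
  "smooth_on f S \<Longrightarrow> smooth_on (\<lambda>x. frechet_derivative f (at x) v) S"
  unfolding smooth_on_def by (metis times_differentiable_on.simps(2))

lemma smooth_on_bounded_linear: "bounded_linear L \<Longrightarrow> open S \<Longrightarrow> smooth_on f S \<Longrightarrow> smooth_on (\<lambda>x. L (f x)) S"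
  unfolding smooth_on_def using times_differentiable_on_bounded_linear_comp by blast

lemma smooth_on_id: "open S \<Longrightarrow> smooth_on (\<lambda>x. x) S"
proof -
  assume S: "open S"
  have "times_differentiable_on k (\<lambda>x. x) S" for k
    by (cases k) (auto simp: frechet_derivative_ident times_differentiable_on_const)
  then show ?thesis using S by (simp add: smooth_on_def)
qed

lemma smooth_on_differentiable: "smooth_on f S \<Longrightarrow> x \<in> S \<Longrightarrow> f differentiable (at x)"
  unfolding smooth_on_def by (metis times_differentiable_on.simps(2))


section \<open>Tangent vectors\<close>

locale manifold_loc =
  fixes M :: "('a, 'n::finite) manifold"
  assumes smooth_manifold: "smooth_manifold M"
begin

section \<open>Charts and smooth functions on the manifold\<close>

abbreviation opn :: "'a set \<Rightarrow> bool" where "opn \<equiv> openin (mtop M)"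

lemma chart_open: "(V, \<phi>) \<in> charts M \<Longrightarrow> opn V"
  and chart_image_open: "(V, \<phi>) \<in> charts M \<Longrightarrow> open (\<phi> ` V)"
  and chart_homeo: "(V, \<phi>) \<in> charts M \<Longrightarrow>
    homeomorphic_map (subtopology (mtop M) V) (top_of_set (\<phi> ` V)) \<phi>"
  and transition_smooth: "(V, \<phi>) \<in> charts M \<Longrightarrow> (W, \<psi>) \<in> charts M \<Longrightarrow>
    smooth_on (\<psi> \<circ> inv_into V \<phi>) (\<phi> ` (V \<inter> W))"
  using smooth_manifold unfolding smooth_manifold_def by blast+

lemma chart_exists: "p \<in> topspace (mtop M) \<Longrightarrow> \<exists>V \<phi>. (V, \<phi>) \<in> charts M \<and> p \<in> V"
  using smooth_manifold unfolding smooth_manifold_def by blast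

lemma chart_inj: assumes "(V, \<phi>) \<in> charts M" shows "inj_on \<phi> V"
proof -
  have "topspace (mtop M) \<inter> V = V"
    using openin_subset[OF chart_open[OF assms]] by auto
  then show ?thesis
    using homeomorphic_imp_injective_map[OF chart_homeo[OF assms]] by simp
qed

lemma chart_inv: "(V, \<phi>) \<in> charts M \<Longrightarrow> q \<in> V \<Longrightarrow> inv_into V \<phi> (\<phi> q) = q"
  using chart_inj inv_into_f_f by metis

lemma chart_image_open_Int:
  assumes "(V, \<phi>) \<in> charts M" "opn W" shows "open (\<phi> ` (W \<inter> V))"
proof -
  have "openin (top_of_set (\<phi> ` V)) (\<phi> ` (W \<inter> V))"
    using homeomorphic_imp_open_map[OF chart_homeo[OF assms(1)]] assms(2)
    unfolding open_map_def by (simp add: openin_subtopology) blast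
  then show ?thesis using chart_image_open[OF assms(1)] openin_open_trans by blast
qed

lemma smooth_funI: "opn U \<Longrightarrow>
    (\<And>V \<phi>. (V, \<phi>) \<in> charts M \<Longrightarrow> smooth_on (u \<circ> inv_into V \<phi>) (\<phi> ` (U \<inter> V))) \<Longrightarrow> smooth_fun M U u"
  unfolding smooth_fun_def by blast

lemma smooth_fun_open: "smooth_fun M U u \<Longrightarrow> opn U"
  unfolding smooth_fun_def by blast

lemma smooth_fun_on_chart: "smooth_fun M U u \<Longrightarrow> (V, \<phi>) \<in> charts M \<Longrightarrow>
    smooth_on (u \<circ> inv_into V \<phi>) (\<phi> ` (U \<inter> V))"
  unfolding smooth_fun_def by blast

lemma smooth_fun_subset: "smooth_fun M U u \<Longrightarrow> opn W \<Longrightarrow> W \<subseteq> U \<Longrightarrow> smooth_fun M W u"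
  by (rule smooth_funI)
    (auto intro!: smooth_on_subset[OF smooth_fun_on_chart] chart_image_open_Int)

lemma smooth_fun_cong:
  assumes "\<And>p. p \<in> U \<Longrightarrow> u p = w p" shows "smooth_fun M U u \<longleftrightarrow> smooth_fun M U w"
proof -
  have "smooth_on (u \<circ> inv_into V \<phi>) (\<phi> ` (U \<inter> V)) \<longleftrightarrow>
      smooth_on (w \<circ> inv_into V \<phi>) (\<phi> ` (U \<inter> V))"
    if "(V, \<phi>) \<in> charts M" for V \<phi>
    by (rule smooth_on_cong) (use assms chart_inv[OF that] in auto)
  then show ?thesis unfolding smooth_fun_def by blast
qed

lemma smooth_fun_const: "opn U \<Longrightarrow> smooth_fun M U (\<lambda>p. c)"
  by (rule smooth_funI) (auto simp: o_def intro!: smooth_on_const chart_image_open_Int)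

lemma smooth_fun_add: "smooth_fun M U u \<Longrightarrow> smooth_fun M U w \<Longrightarrow> smooth_fun M U (\<lambda>p. u p + w p)"
  unfolding smooth_fun_def by (force simp: o_def intro!: smooth_on_add)

lemma smooth_fun_mult: "smooth_fun M U u \<Longrightarrow> smooth_fun M U w \<Longrightarrow> smooth_fun M U (\<lambda>p. u p * w p)"
  unfolding smooth_fun_def by (force simp: o_def intro!: smooth_on_mult)

lemma smooth_fun_minus: "smooth_fun M U u \<Longrightarrow> smooth_fun M U (\<lambda>p. - u p)"
  using smooth_fun_mult[OF smooth_fun_const[of U "-1"]] smooth_fun_open[of U u] by simp

lemma smooth_fun_diff: "smooth_fun M U u \<Longrightarrow> smooth_fun M U w \<Longrightarrow> smooth_fun M U (\<lambda>p. u p - w p)"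
  using smooth_fun_add[of U u "\<lambda>p. - w p"] smooth_fun_minus by simp

lemma smooth_fun_sum: "opn U \<Longrightarrow> (\<And>i. i \<in> I \<Longrightarrow> smooth_fun M U (u i)) \<Longrightarrow>
    smooth_fun M U (\<lambda>p. \<Sum>i\<in>I. u i p)"
  by (induction I rule: infinite_finite_induct) (auto intro: smooth_fun_const smooth_fun_add)

lemma smooth_fun_powr:
  assumes "smooth_fun M U u" "\<And>p. p \<in> U \<Longrightarrow> u p > 0"
  shows "smooth_fun M U (\<lambda>p. u p powr a)"
proof (rule smooth_funI)
  fix V \<phi> assume c: "(V, \<phi>) \<in> charts M"
  have "smooth_on (\<lambda>x. (u \<circ> inv_into V \<phi>) x powr a) (\<phi> ` (U \<inter> V))"
    using assms chart_inv[OF c] by (intro smooth_on_powr smooth_fun_on_chart[OF _ c]) auto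
  then show "smooth_on ((\<lambda>p. u p powr a) \<circ> inv_into V \<phi>) (\<phi> ` (U \<inter> V))" by (simp add: o_def)
qed (rule smooth_fun_open[OF assms(1)])

text \<open>Smoothness asks for every chart of the atlas. Inside one chart domain the other charts
  are reached by composing with a transition map, so a single representation is enough.\<close>

lemma smooth_fun_in_chart:
  assumes c: "(V, \<phi>) \<in> charts M" and W: "opn W" "W \<subseteq> V"
    and s: "smooth_on (u \<circ> inv_into V \<phi>) (\<phi> ` W)"
  shows "smooth_fun M W u"
proof (rule smooth_funI[OF W(1)])
  fix V' \<psi> assume c': "(V', \<psi>) \<in> charts M"
  have "smooth_on (\<phi> \<circ> inv_into V' \<psi>) (\<psi> ` (W \<inter> V'))"
    using W by (intro smooth_on_subset[OF transition_smooth[OF c' c]] chart_image_open_Int[OF c']) auto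
  then have "smooth_on ((u \<circ> inv_into V \<phi>) \<circ> (\<phi> \<circ> inv_into V' \<psi>)) (\<psi> ` (W \<inter> V'))"
    using chart_inv[OF c'] by (intro smooth_on_compose[OF s]) auto
  then show "smooth_on (u \<circ> inv_into V' \<psi>) (\<psi> ` (W \<inter> V'))"
    by (rule smooth_on_cong[THEN iffD1, rotated]) (use chart_inv[OF c'] chart_inv[OF c] W in auto)
qed

lemma smooth_fun_coord:
  assumes c: "(V, \<phi>) \<in> charts M" shows "smooth_fun M V (\<lambda>q. \<phi> q $ k)"
proof (rule smooth_fun_in_chart[OF c chart_open[OF c] subset_refl])
  have "smooth_on (\<lambda>x. x $ k) (\<phi> ` V)"
    using chart_image_open[OF c] smooth_on_id smooth_on_bounded_linear bounded_linear_vec_nth by blast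
  then show "smooth_on ((\<lambda>q. \<phi> q $ k) \<circ> inv_into V \<phi>) (\<phi> ` V)"
    by (rule smooth_on_cong[THEN iffD1, rotated]) (use chart_inv[OF c] in auto)
qed

section \<open>Germs of functions and tangent vectors in a chart\<close>

lemma smooth_nearI: "p \<in> U \<Longrightarrow> smooth_fun M U u \<Longrightarrow> smooth_near M p u"
  unfolding smooth_near_def by blast

lemma smooth_near_cong:
  assumes "opn U" "p \<in> U" "\<And>q. q \<in> U \<Longrightarrow> u q = w q"
  shows "smooth_near M p u \<longleftrightarrow> smooth_near M p w"
proof -
  have "smooth_near M p w" if "smooth_near M p u" and eq: "\<And>q. q \<in> U \<Longrightarrow> u q = w q" for u w
  proof -
    from that obtain W where W: "p \<in> W" "smooth_fun M W u" unfolding smooth_near_def by blast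
    have "smooth_fun M (U \<inter> W) u"
      using W assms smooth_fun_open by (intro smooth_fun_subset[OF W(2)]) auto
    then have "smooth_fun M (U \<inter> W) w" using smooth_fun_cong[of "U \<inter> W" u w] eq by auto
    then show ?thesis using W assms(2) by (intro smooth_nearI[of p "U \<inter> W"]) auto
  qed
  from this[of u w] this[of w u] assms(3) show ?thesis by auto
qed

lemma smooth_near_Int:
  assumes "smooth_near M p u" "smooth_near M p w"
  obtains U where "p \<in> U" "smooth_fun M U u" "smooth_fun M U w"
proof -
  from assms obtain U W where "p \<in> U" "smooth_fun M U u" "p \<in> W" "smooth_fun M W w"
    unfolding smooth_near_def by blast
  moreover from this have "opn (U \<inter> W)" using smooth_fun_open by blast
  ultimately show ?thesis
    using that[of "U \<inter> W"] smooth_fun_subset[of U u "U \<inter> W"] smooth_fun_subset[of W w "U \<inter> W"]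
    by blast
qed

text \<open>The default 0 on functions that are not smooth near \<open>p\<close> is that of
  \<open>velocity\<close>, so that chart vectors and velocities can be equal as total
  functions.\<close>

definition chart_vec :: "'a set \<Rightarrow> ('a \<Rightarrow> real ^ 'n) \<Rightarrow> 'a \<Rightarrow> real ^ 'n \<Rightarrow> 'a tvec" where
  "chart_vec V \<phi> p a = (\<lambda>u. if smooth_near M p u
     then frechet_derivative (u \<circ> inv_into V \<phi>) (at (\<phi> p)) a else 0)"

lemma chart_differentiable:
  assumes c: "(V, \<phi>) \<in> charts M" and "p \<in> V" "smooth_near M p u"
  shows "(u \<circ> inv_into V \<phi>) differentiable (at (\<phi> p))"
  using assms smooth_fun_on_chart[OF _ c] smooth_on_differentiable unfolding smooth_near_def by blast

lemma chart_has_derivative: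
  assumes c: "(V, \<phi>) \<in> charts M" and "p \<in> V" "smooth_near M p u"
  shows "((u \<circ> inv_into V \<phi>) has_derivative (\<lambda>a. chart_vec V \<phi> p a u)) (at (\<phi> p))"
  using frechet_derivative_works[THEN iffD1, OF chart_differentiable[OF assms]] assms(3)
  by (simp add: chart_vec_def)

text \<open>By uniqueness of derivatives, a chart vector can be evaluated from any derivative of the
  representation that is at hand. Additivity, the product rule and locality of tangent vectors all
  come from this.\<close>

lemma chart_vec_eqI:
  assumes c: "(V, \<phi>) \<in> charts M" and "p \<in> V" "smooth_near M p u"
    and "((u \<circ> inv_into V \<phi>) has_derivative L) (at (\<phi> p))"
  shows "chart_vec V \<phi> p a u = L a"
  using has_derivative_unique[OF chart_has_derivative[OF assms(1-3)] assms(4)] by (rule fun_cong)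

lemma chart_vec_lin:
  assumes c: "(V, \<phi>) \<in> charts M" and "p \<in> V"
  shows "chart_vec V \<phi> p (s *\<^sub>R a + t *\<^sub>R b) = (\<lambda>u. s * chart_vec V \<phi> p a u + t * chart_vec V \<phi> p b u)"
proof
  fix u
  show "chart_vec V \<phi> p (s *\<^sub>R a + t *\<^sub>R b) u = s * chart_vec V \<phi> p a u + t * chart_vec V \<phi> p b u"
  proof (cases "smooth_near M p u")
    case True
    then have "linear (\<lambda>a. chart_vec V \<phi> p a u)"
      using chart_has_derivative[OF assms] has_derivative_linear by blast
    from linear_add[OF this, of "s *\<^sub>R a" "t *\<^sub>R b"] linear_cmul[OF this, of s a]
      linear_cmul[OF this, of t b]
    show ?thesis by simp
  qed (simp add: chart_vec_def)
qed

text \<open>The coordinate functions recover the direction from the tangent vector. In the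
  Gram-Schmidt process they certify that a vector is not zero.\<close>

lemma chart_vec_coord:
  assumes c: "(V, \<phi>) \<in> charts M" and p: "p \<in> V"
  shows "chart_vec V \<phi> p a (\<lambda>q. \<phi> q $ k) = a $ k"
proof (rule chart_vec_eqI[OF assms])
  show "smooth_near M p (\<lambda>q. \<phi> q $ k)" using smooth_nearI[OF p smooth_fun_coord[OF c]] .
  have "((\<lambda>x. x $ k) has_derivative (\<lambda>a. a $ k)) (at (\<phi> p))"
    using bounded_linear_imp_has_derivative[OF bounded_linear_vec_nth] .
  then show "((\<lambda>q. \<phi> q $ k) \<circ> inv_into V \<phi> has_derivative (\<lambda>a. a $ k)) (at (\<phi> p))"
    by (rule has_derivative_transform_within_open[OF _ chart_image_open[OF c]])
      (use p chart_inv[OF c] in auto)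
qed

lemma velocity_chart:
  assumes c: "(V, \<phi>) \<in> charts M" and p: "c 0 \<in> V" and sc: "smooth_curve M c"
  shows "velocity M c = chart_vec V \<phi> (c 0) (frechet_derivative (\<phi> \<circ> c) (at 0) 1)"
proof
  fix u
  obtain e :: real where e: "e > 0" "smooth_on (\<phi> \<circ> c) {t \<in> {-e<..<e}. c t \<in> V}"
    using sc c unfolding smooth_curve_def by blast
  let ?T = "{t \<in> {-e<..<e}. c t \<in> V}"
  have T: "open ?T" "0 \<in> ?T" using e p unfolding smooth_on_def by auto
  have dc: "((\<phi> \<circ> c) has_derivative frechet_derivative (\<phi> \<circ> c) (at 0)) (at 0)"
    using smooth_on_differentiable[OF e(2) T(2)] frechet_derivative_works by blast
  show "velocity M c u = chart_vec V \<phi> (c 0) (frechet_derivative (\<phi> \<circ> c) (at 0) 1) u"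
  proof (cases "smooth_near M (c 0) u")
    case True
    let ?L = "\<lambda>a. chart_vec V \<phi> (c 0) a u"
    have F: "((u \<circ> inv_into V \<phi>) has_derivative ?L) (at ((\<phi> \<circ> c) 0))"
      using chart_has_derivative[OF c p True] by simp
    have "((u \<circ> inv_into V \<phi>) \<circ> (\<phi> \<circ> c) has_derivative ?L \<circ> frechet_derivative (\<phi> \<circ> c) (at 0)) (at 0)"
      by (rule diff_chain_at[OF dc F])
    then have d: "((\<lambda>t. u (c t)) has_derivative ?L \<circ> frechet_derivative (\<phi> \<circ> c) (at 0)) (at 0)"
      by (rule has_derivative_transform_within_open[OF _ T]) (use chart_inv[OF c] in auto)
    have lin: "h t = h 1 * t" if "linear h" for h :: "real \<Rightarrow> real" and t
      using linear_cmul[OF that, of t 1] by (simp add: mult.commute)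
    have "(?L \<circ> frechet_derivative (\<phi> \<circ> c) (at 0)) t =
        ?L (frechet_derivative (\<phi> \<circ> c) (at 0) 1) * t" for t
      using lin[OF has_derivative_linear[OF d], of t] by (simp only: o_apply)
    then have "((\<lambda>t. u (c t)) has_real_derivative
        ?L (frechet_derivative (\<phi> \<circ> c) (at 0) 1)) (at 0)"
      unfolding has_field_derivative_def
      by (intro has_derivative_eq_rhs[OF d]) (simp only: fun_eq_iff simp_thms)
    then show ?thesis using True by (simp add: velocity_def DERIV_imp_deriv)
  qed (simp add: velocity_def chart_vec_def)
qed

text \<open>Every chart direction has to occur as the velocity of a curve. A straight segment in the
  chart, carried back to the manifold, provides one.\<close>

lemma line_curve:
  assumes c: "(V, \<phi>) \<in> charts M" and p: "p \<in> V"
  obtains c where "smooth_curve M c" "c 0 = p" "frechet_derivative (\<phi> \<circ> c) (at 0) 1 = a"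
proof -
  obtain r where r: "r > 0" "ball (\<phi> p) r \<subseteq> \<phi> ` V"
    using chart_image_open[OF c] p open_contains_ball by blast
  \<comment> \<open>Adding 1 to \<open>norm a\<close> keeps the denominator positive for
    \<open>a = 0\<close> and makes \<open>norm (t *\<^sub>R a) < r\<close> for all \<open>t\<close>
    in the interval.\<close>
  define e where "e = r / (norm a + 1)"
  have na: "norm a + 1 > 0" by (simp add: add_nonneg_pos)
  then have e: "e > 0" using r by (simp add: e_def)
  define l where "l = (\<lambda>t::real. \<phi> p + t *\<^sub>R a)"
  define k where "k = (\<lambda>t. inv_into V \<phi> (l t))"
  have lV: "l t \<in> \<phi> ` V" if "t \<in> {-e<..<e}" for t
  proof -
    have "norm (t *\<^sub>R a) = \<bar>t\<bar> * norm a" by simp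
    also have "\<dots> \<le> \<bar>t\<bar> * (norm a + 1)" by (intro mult_left_mono) auto
    also have "\<dots> < e * (norm a + 1)" using that na by (intro mult_strict_right_mono) auto
    also have "\<dots> = r" using na by (simp add: e_def)
    finally have "l t \<in> ball (\<phi> p) r" by (simp add: l_def dist_norm)
    then show ?thesis using r by auto
  qed
  then have \<phi>k: "\<phi> (k t) = l t" and kV: "k t \<in> V" if "t \<in> {-e<..<e}" for t
    using that f_inv_into_f[of "l t" \<phi> V] inv_into_into[of "l t" \<phi> V] by (auto simp: k_def)
  \<comment> \<open>Preimages under \<open>k\<close> become preimages under the affine map
    \<open>l\<close> of images under \<open>\<phi>\<close>. For open \<open>W\<close> these images
    are open, which replaces an argument about continuity of \<open>inv_into\<close>.\<close>
  have kW: "{t \<in> {-e<..<e}. k t \<in> W} = {-e<..<e} \<inter> l -` (\<phi> ` (W \<inter> V))" for W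
  proof -
    have "k t \<in> W \<longleftrightarrow> l t \<in> \<phi> ` (W \<inter> V)" if "t \<in> {-e<..<e}" for t
      using \<phi>k[OF that] kV[OF that] chart_inv[OF c] by (metis IntD1 IntD2 IntI imageE imageI k_def)
    then show ?thesis by auto
  qed
  have l0: "bounded_linear (\<lambda>t::real. t *\<^sub>R a)" by (rule bounded_linear_scaleR_left)
  have sl: "smooth_on l S" if "open S" for S
    unfolding l_def
    by (intro smooth_on_add smooth_on_const smooth_on_bounded_linear[OF l0] smooth_on_id that)
  have cl: "continuous_on UNIV l" unfolding l_def by (intro continuous_intros)
  have ok: "open {t \<in> {-e<..<e}. k t \<in> W}" if "opn W" for W
    unfolding kW using chart_image_open_Int[OF c that] cl
    by (intro open_Int open_vimage) auto
  have "continuous_map (top_of_set {-e<..<e}) (mtop M) k"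
    unfolding continuous_map_def
  proof (intro conjI allI impI)
    show "k \<in> topspace (top_of_set {-e<..<e}) \<rightarrow> topspace (mtop M)"
      using kV openin_subset[OF chart_open[OF c]] by auto
    show "openin (top_of_set {-e<..<e}) {x \<in> topspace (top_of_set {-e<..<e}). k x \<in> U}"
      if "opn U" for U
      using ok[OF that] by (intro open_openin_trans) auto
  qed
  moreover have "smooth_on (\<psi> \<circ> k) {t \<in> {-e<..<e}. k t \<in> W}" if d: "(W, \<psi>) \<in> charts M" for W \<psi>
  proof -
    have "smooth_on ((\<psi> \<circ> inv_into V \<phi>) \<circ> l) {t \<in> {-e<..<e}. k t \<in> W}"
      by (rule smooth_on_compose[OF transition_smooth[OF c d] sl[OF ok[OF chart_open[OF d]]]])
        (unfold kW, blast)
    then show ?thesis by (simp add: k_def o_def)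
  qed
  ultimately have "smooth_curve M k" unfolding smooth_curve_def using e by blast
  moreover have "k 0 = p" using chart_inv[OF c p] by (simp add: k_def l_def)
  moreover have "(l has_derivative (\<lambda>t. t *\<^sub>R a)) (at 0)"
    unfolding l_def by (auto intro!: derivative_eq_intros)
  then have "((\<phi> \<circ> k) has_derivative (\<lambda>t. t *\<^sub>R a)) (at 0)"
    by (rule has_derivative_transform_within_open[OF _ open_greaterThanLessThan[of "-e" e]]) (use e \<phi>k in auto)
  then have "(\<lambda>t. t *\<^sub>R a) = frechet_derivative (\<phi> \<circ> k) (at 0)" by (rule frechet_derivative_at)
  then have "frechet_derivative (\<phi> \<circ> k) (at 0) 1 = a" by (metis scaleR_one)
  ultimately show ?thesis using that by blast
qed

text \<open>A set of velocities is not visibly a vector space. The chart identifies it with all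
  directions in \<open>real ^ 'n\<close>, and linear combinations are then taken there
  (\<open>tangent_space_lin\<close>).\<close>

lemma tangent_space_chart:
  assumes c: "(V, \<phi>) \<in> charts M" and p: "p \<in> V"
  shows "tangent_space M p = range (chart_vec V \<phi> p)"
proof
  show "tangent_space M p \<subseteq> range (chart_vec V \<phi> p)"
    using velocity_chart[OF c] p unfolding tangent_space_def by blast
  show "range (chart_vec V \<phi> p) \<subseteq> tangent_space M p"
  proof clarify
    fix a
    obtain k where "smooth_curve M k" "k 0 = p" "frechet_derivative (\<phi> \<circ> k) (at 0) 1 = a"
      using line_curve[OF c p] .
    then show "chart_vec V \<phi> p a \<in> tangent_space M p"
      using velocity_chart[OF c, of k] p unfolding tangent_space_def
      by (intro CollectI exI[of _ k]) simp
  qed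
qed

lemma tangent_vecE:
  assumes "p \<in> topspace (mtop M)" "v \<in> tangent_space M p"
  obtains V \<phi> a where "(V, \<phi>) \<in> charts M" "p \<in> V" "v = chart_vec V \<phi> p a"
  using chart_exists[OF assms(1)] tangent_space_chart assms(2) by (metis imageE)

lemma tangent_space_lin:
  assumes "p \<in> topspace (mtop M)" "v \<in> tangent_space M p" "w \<in> tangent_space M p"
  shows "(\<lambda>u. s * v u + t * w u) \<in> tangent_space M p"
proof -
  obtain V \<phi> where c: "(V, \<phi>) \<in> charts M" "p \<in> V" using chart_exists[OF assms(1)] by blast
  then obtain a b where "v = chart_vec V \<phi> p a" "w = chart_vec V \<phi> p b"
    using tangent_space_chart assms by blast
  then have "(\<lambda>u. s * v u + t * w u) = chart_vec V \<phi> p (s *\<^sub>R a + t *\<^sub>R b)"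
    using chart_vec_lin[OF c] by simp
  then show ?thesis using tangent_space_chart[OF c] by simp
qed

lemma tangent_vec_not_smooth:
  "v \<in> tangent_space M p \<Longrightarrow> \<not> smooth_near M p u \<Longrightarrow> v u = 0"
  unfolding tangent_space_def by (auto simp: velocity_def)

lemma tangent_vec_add:
  assumes "p \<in> topspace (mtop M)" "v \<in> tangent_space M p" "smooth_near M p u" "smooth_near M p w"
  shows "v (\<lambda>q. u q + w q) = v u + v w"
proof -
  obtain V \<phi> a where c: "(V, \<phi>) \<in> charts M" "p \<in> V" and v: "v = chart_vec V \<phi> p a"
    using tangent_vecE[OF assms(1,2)] .
  have "smooth_near M p (\<lambda>q. u q + w q)"
    using smooth_near_Int[OF assms(3,4)] smooth_fun_add smooth_nearI by metis
  moreover have "((\<lambda>q. u q + w q) \<circ> inv_into V \<phi> has_derivative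
      (\<lambda>a. chart_vec V \<phi> p a u + chart_vec V \<phi> p a w)) (at (\<phi> p))"
    using has_derivative_add[OF chart_has_derivative[OF c assms(3)] chart_has_derivative[OF c assms(4)]]
    by (simp add: o_def)
  ultimately show ?thesis unfolding v by (rule chart_vec_eqI[OF c])
qed

lemma tangent_vec_mult:
  assumes "p \<in> topspace (mtop M)" "v \<in> tangent_space M p" "smooth_near M p u" "smooth_near M p w"
  shows "v (\<lambda>q. u q * w q) = u p * v w + v u * w p"
proof -
  obtain V \<phi> a where c: "(V, \<phi>) \<in> charts M" "p \<in> V" and v: "v = chart_vec V \<phi> p a"
    using tangent_vecE[OF assms(1,2)] .
  have "smooth_near M p (\<lambda>q. u q * w q)"
    using smooth_near_Int[OF assms(3,4)] smooth_fun_mult smooth_nearI by metis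
  moreover have "((\<lambda>q. u q * w q) \<circ> inv_into V \<phi> has_derivative
      (\<lambda>a. u p * chart_vec V \<phi> p a w + chart_vec V \<phi> p a u * w p)) (at (\<phi> p))"
    using has_derivative_mult[OF chart_has_derivative[OF c assms(3)] chart_has_derivative[OF c assms(4)]]
    using chart_inv[OF c] by (simp add: o_def)
  ultimately show ?thesis unfolding v by (rule chart_vec_eqI[OF c])
qed

lemma tangent_vec_const:
  assumes "p \<in> topspace (mtop M)" "v \<in> tangent_space M p"
  shows "v (\<lambda>q. s) = 0"
proof -
  have sn: "smooth_near M p (\<lambda>q. s)" for s
    using assms(1) by (intro smooth_nearI[OF _ smooth_fun_const]) auto
  obtain V \<phi> a where c: "(V, \<phi>) \<in> charts M" "p \<in> V" and v: "v = chart_vec V \<phi> p a"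
    using tangent_vecE[OF assms] .
  show ?thesis unfolding v
    by (rule chart_vec_eqI[OF c sn, where L = "\<lambda>a. 0"]) (simp add: o_def)
qed

text \<open>Representations that agree near \<open>\<phi> p\<close> share their derivative. If one
  function is not smooth near \<open>p\<close>, neither is the other, and both values are the
  default 0.\<close>

lemma tangent_vec_cong:
  assumes "v \<in> tangent_space M p" "opn U" "p \<in> U" "\<And>q. q \<in> U \<Longrightarrow> u q = w q"
  shows "v u = v w"
proof -
  have "p \<in> topspace (mtop M)" using assms openin_subset by blast
  then obtain V \<phi> a where c: "(V, \<phi>) \<in> charts M" "p \<in> V" and v: "v = chart_vec V \<phi> p a"
    using tangent_vecE assms(1) by metis
  show ?thesis
  proof (cases "smooth_near M p w")
    case True
    then have u: "smooth_near M p u" using smooth_near_cong[OF assms(2-4)] by simp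
    show ?thesis unfolding v
    proof (rule chart_vec_eqI[OF c u])
      show "(u \<circ> inv_into V \<phi> has_derivative (\<lambda>a. chart_vec V \<phi> p a w)) (at (\<phi> p))"
        by (rule has_derivative_transform_within_open[OF chart_has_derivative[OF c True]
              chart_image_open_Int[OF c(1) assms(2)]])
          (use assms c chart_inv[OF c(1)] in auto)
    qed
  next
    case False
    then have "\<not> smooth_near M p u" using smooth_near_cong[OF assms(2-4)] by simp
    then show ?thesis using False tangent_vec_not_smooth[OF assms(1)] by simp
  qed
qed


section \<open>Vector fields and orthonormal frames\<close>

abbreviation VF :: "'a set \<Rightarrow> 'a vfield set" where "VF \<equiv> vector_fields M"

lemma open_points: "opn U \<Longrightarrow> p \<in> U \<Longrightarrow> p \<in> topspace (mtop M)"
  using openin_subset by blast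

lemma vf_tangent: "X \<in> VF U \<Longrightarrow> p \<in> U \<Longrightarrow> X p \<in> tangent_space M p"
  and vf_smooth: "X \<in> VF U \<Longrightarrow> smooth_fun M V u \<Longrightarrow> V \<subseteq> U \<Longrightarrow> smooth_fun M V (\<lambda>p. X p u)"
  unfolding vector_fields_def by blast+

lemma vfI: "(\<And>p. p \<in> U \<Longrightarrow> X p \<in> tangent_space M p) \<Longrightarrow>
   (\<And>V u. V \<subseteq> U \<Longrightarrow> smooth_fun M V u \<Longrightarrow> smooth_fun M V (\<lambda>p. X p u)) \<Longrightarrow> X \<in> VF U"
  unfolding vector_fields_def by blast

lemma vf_subset: "X \<in> VF U \<Longrightarrow> W \<subseteq> U \<Longrightarrow> X \<in> VF W"
  unfolding vector_fields_def by blast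

lemma vf_cong: assumes "X \<in> VF U" "\<And>p. p \<in> U \<Longrightarrow> Y p = X p" shows "Y \<in> VF U"
proof (rule vfI)
  show "Y p \<in> tangent_space M p" if "p \<in> U" for p using assms vf_tangent that by simp
  show "smooth_fun M V (\<lambda>p. Y p u)" if "V \<subseteq> U" "smooth_fun M V u" for V u
    using vf_smooth[OF assms(1) that(2,1)] smooth_fun_cong[of V "\<lambda>p. Y p u" "\<lambda>p. X p u"] assms(2) that
    by (simp add: subset_iff)
qed

lemma vf_lin_comb:
  assumes "smooth_fun M U a" "smooth_fun M U b" "X \<in> VF U" "Y \<in> VF U"
  shows "(\<lambda>p u. a p * X p u + b p * Y p u) \<in> VF U"
proof (rule vfI)
  show "(\<lambda>u. a p * X p u + b p * Y p u) \<in> tangent_space M p" if "p \<in> U" for p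
    using assms that open_points[OF smooth_fun_open[OF assms(1)]]
    by (intro tangent_space_lin) (auto intro: vf_tangent)
  show "smooth_fun M V (\<lambda>p. a p * X p u + b p * Y p u)" if "V \<subseteq> U" "smooth_fun M V u" for V u
    using assms(1,2)[THEN smooth_fun_subset, OF smooth_fun_open[OF that(2)] that(1)]
      assms(3,4)[THEN vf_smooth, OF that(2,1)]
    by (simp add: smooth_fun_add smooth_fun_mult)
qed

lemma vf_add: "opn U \<Longrightarrow> X \<in> VF U \<Longrightarrow> Y \<in> VF U \<Longrightarrow> (\<lambda>p u. X p u + Y p u) \<in> VF U"
  using vf_lin_comb[OF smooth_fun_const[of U 1] smooth_fun_const[of U 1]] by simp

lemma vf_diff: "opn U \<Longrightarrow> X \<in> VF U \<Longrightarrow> Y \<in> VF U \<Longrightarrow> (\<lambda>p u. X p u - Y p u) \<in> VF U"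
  using vf_lin_comb[OF smooth_fun_const[of U 1] smooth_fun_const[of U "-1"]] by simp

lemma vf_scale: "smooth_fun M U a \<Longrightarrow> X \<in> VF U \<Longrightarrow> (\<lambda>p u. a p * X p u) \<in> VF U"
  using vf_lin_comb[OF _ smooth_fun_const[of U 0]] smooth_fun_open by force

lemma vf_zero: assumes "opn U" shows "(\<lambda>p u. 0) \<in> VF U"
proof (rule vfI)
  fix p assume "p \<in> U"
  then have p: "p \<in> topspace (mtop M)" using open_points[OF assms] by blast
  obtain V \<phi> where "(V, \<phi>) \<in> charts M" "p \<in> V" using chart_exists[OF p] by blast
  then have "chart_vec V \<phi> p 0 \<in> tangent_space M p" using tangent_space_chart by simp
  from tangent_space_lin[OF p this this, of 0 0] show "(\<lambda>u. 0) \<in> tangent_space M p" by simp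
qed (use smooth_fun_const smooth_fun_open in blast)

lemma vf_sum:
  assumes "opn U" "\<And>i. i \<in> I \<Longrightarrow> smooth_fun M U (a i)" "\<And>i. i \<in> I \<Longrightarrow> X i \<in> VF U"
  shows "(\<lambda>p u. \<Sum>i\<in>I. a i p * X i p u) \<in> VF U"
  using assms(2,3)
proof (induction I rule: infinite_finite_induct)
  case (insert j I)
  then have "(\<lambda>p u. a j p * X j p u + (\<Sum>i\<in>I. a i p * X i p u)) \<in> VF U"
    by (intro vf_add assms(1) vf_scale) auto
  then show ?case using insert by simp
qed (simp_all add: vf_zero assms(1))

lemma der_add: "opn U \<Longrightarrow> X \<in> VF U \<Longrightarrow> p \<in> U \<Longrightarrow> smooth_fun M U u \<Longrightarrow> smooth_fun M U w \<Longrightarrow>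
    X p (\<lambda>q. u q + w q) = X p u + X p w"
  by (rule tangent_vec_add) (auto intro: open_points vf_tangent smooth_nearI)

lemma der_mult: "opn U \<Longrightarrow> X \<in> VF U \<Longrightarrow> p \<in> U \<Longrightarrow> smooth_fun M U u \<Longrightarrow> smooth_fun M U w \<Longrightarrow>
    X p (\<lambda>q. u q * w q) = u p * X p w + X p u * w p"
  by (rule tangent_vec_mult) (auto intro: open_points vf_tangent smooth_nearI)

lemma der_const: "opn U \<Longrightarrow> X \<in> VF U \<Longrightarrow> p \<in> U \<Longrightarrow> X p (\<lambda>q. s) = 0"
  by (rule tangent_vec_const) (auto intro: open_points vf_tangent)

lemma der_cmult: "opn U \<Longrightarrow> X \<in> VF U \<Longrightarrow> p \<in> U \<Longrightarrow> smooth_fun M U u \<Longrightarrow> X p (\<lambda>q. s * u q) = s * X p u"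
  using der_mult[of U X p "\<lambda>q. s" u] smooth_fun_const[of U s] der_const[of U X p s] by simp

lemma der_minus: "opn U \<Longrightarrow> X \<in> VF U \<Longrightarrow> p \<in> U \<Longrightarrow> smooth_fun M U u \<Longrightarrow> X p (\<lambda>q. - u q) = - X p u"
  using der_cmult[of U X p u "-1"] by simp

lemma der_diff: "opn U \<Longrightarrow> X \<in> VF U \<Longrightarrow> p \<in> U \<Longrightarrow> smooth_fun M U u \<Longrightarrow> smooth_fun M U w \<Longrightarrow>
    X p (\<lambda>q. u q - w q) = X p u - X p w"
  using der_add[of U X p u "\<lambda>q. - w q"] der_minus[of U X p w] smooth_fun_minus[of U w] by simp

lemma der_sum:
  assumes "opn U" "X \<in> VF U" "p \<in> U" "\<And>i. i \<in> I \<Longrightarrow> smooth_fun M U (u i)"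
  shows "X p (\<lambda>q. \<Sum>i\<in>I. u i q) = (\<Sum>i\<in>I. X p (u i))"
  using assms(4)
proof (induction I rule: infinite_finite_induct)
  case (insert j I)
  then have "X p (\<lambda>q. u j q + (\<Sum>i\<in>I. u i q)) = X p (u j) + X p (\<lambda>q. \<Sum>i\<in>I. u i q)"
    by (intro der_add[OF assms(1-3)] smooth_fun_sum[OF assms(1)]) auto
  then show ?case using insert by simp
qed (simp_all add: der_const[OF assms(1-3)])

lemma der_cong: "opn U \<Longrightarrow> X \<in> VF U \<Longrightarrow> p \<in> U \<Longrightarrow> (\<And>q. q \<in> U \<Longrightarrow> u q = w q) \<Longrightarrow> X p u = X p w"
  by (rule tangent_vec_cong) (auto intro: vf_tangent)

definition coord_field :: "'a set \<Rightarrow> ('a \<Rightarrow> real ^ 'n) \<Rightarrow> 'n \<Rightarrow> 'a vfield" where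
  "coord_field V \<phi> k = (\<lambda>q. chart_vec V \<phi> q (axis k 1))"

lemma coord_field_vf: assumes c: "(V, \<phi>) \<in> charts M" shows "coord_field V \<phi> k \<in> VF V"
proof (rule vfI)
  show "coord_field V \<phi> k p \<in> tangent_space M p" if "p \<in> V" for p
    using tangent_space_chart[OF c that] by (simp add: coord_field_def)
  fix W u assume W: "W \<subseteq> V" and u: "smooth_fun M W u"
  have WV: "W \<inter> V = W" using W by blast
  show "smooth_fun M W (\<lambda>p. coord_field V \<phi> k p u)"
  proof (rule smooth_fun_in_chart[OF c smooth_fun_open[OF u] W])
    have "smooth_on (\<lambda>x. frechet_derivative (u \<circ> inv_into V \<phi>) (at x) (axis k 1)) (\<phi> ` W)"
      using smooth_on_frechet_derivative[OF smooth_fun_on_chart[OF u c]] WV by simp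
    then show "smooth_on ((\<lambda>p. coord_field V \<phi> k p u) \<circ> inv_into V \<phi>) (\<phi> ` W)"
      by (rule smooth_on_cong[THEN iffD1, rotated])
        (use W chart_inv[OF c] smooth_nearI[OF _ u] in \<open>auto simp: coord_field_def chart_vec_def subset_eq\<close>)
  qed
qed

end

locale riemannian_loc = manifold_loc M for M :: "('a, 'n::finite) manifold" +
  fixes g :: "'a metric"
  assumes metric: "riemannian_metric M g"
begin

section \<open>The metric on tangent spaces, orthonormal frames and traces\<close>

lemma g_lin: "p \<in> topspace (mtop M) \<Longrightarrow> v \<in> tangent_space M p \<Longrightarrow> w \<in> tangent_space M p \<Longrightarrow>
    z \<in> tangent_space M p \<Longrightarrow> g p (\<lambda>u. a * v u + b * w u) z = a * g p v z + b * g p w z"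
  and g_sym_at: "p \<in> topspace (mtop M) \<Longrightarrow> v \<in> tangent_space M p \<Longrightarrow> w \<in> tangent_space M p \<Longrightarrow>
    g p v w = g p w v"
  and g_pos: "p \<in> topspace (mtop M) \<Longrightarrow> v \<in> tangent_space M p \<Longrightarrow> v \<noteq> (\<lambda>u. 0) \<Longrightarrow> g p v v > 0"
  using metric unfolding riemannian_metric_def by blast+

lemma g_smooth: "opn U \<Longrightarrow> X \<in> VF U \<Longrightarrow> Y \<in> VF U \<Longrightarrow> smooth_fun M U (\<lambda>p. g p (X p) (Y p))"
  using metric unfolding riemannian_metric_def by blast

lemma g_sym: "opn U \<Longrightarrow> p \<in> U \<Longrightarrow> X \<in> VF U \<Longrightarrow> Y \<in> VF U \<Longrightarrow> g p (X p) (Y p) = g p (Y p) (X p)"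
  using g_sym_at open_points vf_tangent by blast

lemma zero_tangent: "p \<in> topspace (mtop M) \<Longrightarrow> (\<lambda>u. 0) \<in> tangent_space M p"
  using vf_tangent[OF vf_zero[OF openin_topspace]] by blast

lemma g_zero: "p \<in> topspace (mtop M) \<Longrightarrow> z \<in> tangent_space M p \<Longrightarrow> g p (\<lambda>u. 0) z = 0"
  using g_lin[of p "\<lambda>u. 0" "\<lambda>u. 0" z 0 0] zero_tangent by simp

lemma tangent_space_sum:
  assumes "p \<in> topspace (mtop M)" "\<And>i. i \<in> I \<Longrightarrow> v i \<in> tangent_space M p"
  shows "(\<lambda>u. \<Sum>i\<in>I. c i * v i u) \<in> tangent_space M p"
  using assms(2)
proof (induction I rule: infinite_finite_induct)
  case (insert j I)
  then show ?case
    using tangent_space_lin[OF assms(1), of "v j" "\<lambda>u. \<Sum>i\<in>I. c i * v i u" "c j" 1] by simp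
qed (simp_all add: zero_tangent[OF assms(1)])

lemma g_sum:
  assumes p: "p \<in> topspace (mtop M)" and z: "z \<in> tangent_space M p"
    and "\<And>i. i \<in> I \<Longrightarrow> v i \<in> tangent_space M p"
  shows "g p (\<lambda>u. \<Sum>i\<in>I. c i * v i u) z = (\<Sum>i\<in>I. c i * g p (v i) z)"
  using assms(3)
proof (induction I rule: infinite_finite_induct)
  case (insert j I)
  then show ?case
    using g_lin[OF p, of "v j" "\<lambda>u. \<Sum>i\<in>I. c i * v i u" z "c j" 1]
      tangent_space_sum[OF p, of I v c] z by simp
qed (simp_all add: g_zero[OF p z])

lemma frameD: "orthonormal_frame M g U E \<Longrightarrow> E i \<in> VF U"
  "orthonormal_frame M g U E \<Longrightarrow> p \<in> U \<Longrightarrow> g p (E i p) (E j p) = (if i = j then 1 else 0)"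
  unfolding orthonormal_frame_def by blast+

lemma g_add1: "p \<in> topspace (mtop M) \<Longrightarrow> v \<in> tangent_space M p \<Longrightarrow> w \<in> tangent_space M p \<Longrightarrow>
    z \<in> tangent_space M p \<Longrightarrow> g p (\<lambda>u. v u + w u) z = g p v z + g p w z"
  using g_lin[of p v w z 1 1] by simp

lemma g_diff1: "p \<in> topspace (mtop M) \<Longrightarrow> v \<in> tangent_space M p \<Longrightarrow> w \<in> tangent_space M p \<Longrightarrow>
    z \<in> tangent_space M p \<Longrightarrow> g p (\<lambda>u. v u - w u) z = g p v z - g p w z"
  using g_lin[of p v w z 1 "-1"] by simp

lemma g_scale1: "p \<in> topspace (mtop M) \<Longrightarrow> v \<in> tangent_space M p \<Longrightarrow>
    z \<in> tangent_space M p \<Longrightarrow> g p (\<lambda>u. a * v u) z = a * g p v z"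
  using g_lin[of p v v z a 0] by simp

lemma tangent_diff: "p \<in> topspace (mtop M) \<Longrightarrow> v \<in> tangent_space M p \<Longrightarrow>
    w \<in> tangent_space M p \<Longrightarrow> (\<lambda>u. v u - w u) \<in> tangent_space M p"
  using tangent_space_lin[of p v w 1 "-1"] by simp

lemma g_lin2: "p \<in> topspace (mtop M) \<Longrightarrow> v \<in> tangent_space M p \<Longrightarrow> w \<in> tangent_space M p \<Longrightarrow>
    z \<in> tangent_space M p \<Longrightarrow> g p z (\<lambda>u. a * v u + b * w u) = a * g p z v + b * g p z w"
  using g_lin[of p v w z a b] g_sym_at[of p z] tangent_space_lin[of p v w a b] by simp

lemma g_diff2: "p \<in> topspace (mtop M) \<Longrightarrow> v \<in> tangent_space M p \<Longrightarrow> w \<in> tangent_space M p \<Longrightarrow>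
    z \<in> tangent_space M p \<Longrightarrow> g p z (\<lambda>u. v u - w u) = g p z v - g p z w"
  using g_lin2[of p v w z 1 "-1"] by simp

text \<open>The vanishing of the components outside \<open>A\<close> replaces the usual condition on spans. It keeps the
  next coordinate field independent of the fields already chosen, and needs no order on the index type.\<close>

lemma gram_schmidt:
  assumes c: "(V, \<phi>) \<in> charts M" and "finite A"
  shows "\<exists>E. (\<forall>i\<in>A. E i \<in> VF V) \<and>
    (\<forall>p\<in>V. \<forall>i\<in>A. \<forall>j\<in>A. g p (E i p) (E j p) = (if i = j then 1 else 0)) \<and>
    (\<forall>p\<in>V. \<forall>i\<in>A. \<forall>k. k \<notin> A \<longrightarrow> E i p (\<lambda>q. \<phi> q $ k) = 0)"
  using assms(2)
proof (induction A rule: finite_induct)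
  case empty
  then show ?case by simp
next
  case (insert j A)
  then obtain E where E: "\<And>i. i \<in> A \<Longrightarrow> E i \<in> VF V"
    "\<And>p i j. p \<in> V \<Longrightarrow> i \<in> A \<Longrightarrow> j \<in> A \<Longrightarrow> g p (E i p) (E j p) = (if i = j then 1 else 0)"
    "\<And>p i k. p \<in> V \<Longrightarrow> i \<in> A \<Longrightarrow> k \<notin> A \<Longrightarrow> E i p (\<lambda>q. \<phi> q $ k) = 0" by blast
  let ?X = "coord_field V \<phi> j"
  have V: "opn V" by (rule chart_open[OF c])
  have X: "?X \<in> VF V" by (rule coord_field_vf[OF c])
  define w where "w = (\<lambda>p u. ?X p u - (\<Sum>i\<in>A. g p (?X p) (E i p) * E i p u))"
  have s: "(\<lambda>p u. \<Sum>i\<in>A. g p (?X p) (E i p) * E i p u) \<in> VF V"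
    using E X V by (intro vf_sum g_smooth) auto
  have w: "w \<in> VF V" unfolding w_def by (intro vf_diff V X s)
  have wk: "w p (\<lambda>q. \<phi> q $ k) = (if k = j then 1 else 0)" if "p \<in> V" "k \<notin> A" for p k
    using that E(3) by (simp add: w_def coord_field_def chart_vec_coord[OF c] axis_def)
  \<comment> \<open>The \<open>j\<close>-th coordinate of \<open>w p\<close> is 1, so
    \<open>w p\<close> is nowhere the zero vector on the chart domain.\<close>
  have N: "g p (w p) (w p) > 0" if "p \<in> V" for p
    using wk[OF that insert.hyps(2)]
    by (intro g_pos open_points[OF V that] vf_tangent[OF w that]) auto
  have wE: "g p (w p) (E i p) = 0" if p: "p \<in> V" and i: "i \<in> A" for p i
  proof -
    have tp: "p \<in> topspace (mtop M)" using open_points[OF V p] .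
    have t: "E i p \<in> tangent_space M p" if "i \<in> A" for i using E(1) vf_tangent p that by blast
    have "g p (w p) (E i p) = g p (?X p) (E i p) -
        g p (\<lambda>u. \<Sum>l\<in>A. g p (?X p) (E l p) * E l p u) (E i p)"
      using g_lin[OF tp vf_tangent[OF X p] vf_tangent[OF s p] t[OF i], of 1 "-1"]
      by (simp add: w_def)
    also have "g p (\<lambda>u. \<Sum>l\<in>A. g p (?X p) (E l p) * E l p u) (E i p) =
        (\<Sum>l\<in>A. g p (?X p) (E l p) * g p (E l p) (E i p))"
      using t i by (intro g_sum tp) auto
    also have "\<dots> = (\<Sum>l\<in>A. if l = i then g p (?X p) (E i p) else 0)"
      using E(2) p i by (intro sum.cong) auto
    also have "\<dots> = g p (?X p) (E i p)" using insert.hyps(1) i by simp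
    finally show ?thesis by simp
  qed
  \<comment> \<open>The reciprocal square root is written as a real power so that
    \<open>smooth_fun_powr\<close> applies, with positivity from \<open>N\<close>.\<close>
  define n where "n = (\<lambda>p. g p (w p) (w p) powr (-1/2))"
  have n: "smooth_fun M V n" unfolding n_def using N by (intro smooth_fun_powr g_smooth V w) auto
  define e where "e = (\<lambda>p u. n p * w p u)"
  have e: "e \<in> VF V" unfolding e_def by (rule vf_scale[OF n w])
  have ge: "g p (e p) z = n p * g p (w p) z" if "p \<in> V" "z \<in> tangent_space M p" for p z
    using g_lin[OF open_points[OF V that(1)] vf_tangent[OF w that(1)] vf_tangent[OF w that(1)] that(2), of "n p" 0]
    by (simp add: e_def)
  have eE: "g p (e p) (E i p) = 0" "g p (E i p) (e p) = 0" if "p \<in> V" "i \<in> A" for p i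
    using ge[OF that(1) vf_tangent[OF E(1)[OF that(2)] that(1)]] wE[OF that]
      g_sym[OF V that(1) e E(1)[OF that(2)]] by auto
  have ee: "g p (e p) (e p) = 1" if "p \<in> V" for p
  proof -
    have "g p (e p) (e p) = n p * g p (w p) (e p)" using ge[OF that vf_tangent[OF e that]] .
    also have "g p (w p) (e p) = n p * g p (w p) (w p)"
      using ge[OF that vf_tangent[OF w that]] g_sym[OF V that e w] by simp
    also have "n p * (n p * g p (w p) (w p)) = (n p * n p) * g p (w p) (w p)" by simp
    also have "n p * n p = g p (w p) (w p) powr (-1)"
      unfolding n_def powr_add[symmetric] by simp
    also have "\<dots> * g p (w p) (w p) = 1" using N[OF that] by (simp add: powr_minus)
    finally show ?thesis .
  qed
  have ek: "e p (\<lambda>q. \<phi> q $ k) = 0" if "p \<in> V" "k \<notin> insert j A" for p k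
    using wk[of p k] that by (simp add: e_def)
  show ?case
    using E e eE ee ek insert.hyps
    by (intro exI[of _ "E(j := e)"]) (auto simp: fun_upd_def)
qed

lemma frame_exists:
  assumes "p \<in> topspace (mtop M)"
  shows "\<exists>U E. opn U \<and> p \<in> U \<and> orthonormal_frame M g U E"
proof -
  obtain V \<phi> where c: "(V, \<phi>) \<in> charts M" "p \<in> V" using chart_exists[OF assms] by blast
  obtain E where "orthonormal_frame M g V E"
    using gram_schmidt[OF c(1), of UNIV] unfolding orthonormal_frame_def by auto
  then show ?thesis using chart_open[OF c(1)] c(2) by blast
qed

lemma frame_at:
  assumes "p \<in> topspace (mtop M)"
  obtains U where "opn U" "p \<in> U" "orthonormal_frame M g U (frame_at M g p)"
proof -
  have "\<exists>E U. opn U \<and> p \<in> U \<and> orthonormal_frame M g U E" using frame_exists[OF assms] by blast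
  then have "\<exists>U. opn U \<and> p \<in> U \<and> orthonormal_frame M g U (frame_at M g p)"
    unfolding frame_at_def by (rule someI_ex)
  then show ?thesis using that by blast
qed

text \<open>There are as many frame vectors as coordinates. The map \<open>L\<close>, which sends
  coefficients to the combination of the frame directions, is an injective endomorphism of
  \<open>real ^ 'n\<close> by orthonormality, hence surjective; pairing with \<open>E j\<close>
  reads off the coefficients.\<close>

lemma frame_expand_at:
  assumes U: "opn U" and E: "orthonormal_frame M g U E" and p: "p \<in> U" and v: "v \<in> tangent_space M p"
  shows "v = (\<lambda>u. \<Sum>i\<in>UNIV. g p v (E i p) * E i p u)"
proof -
  have tp: "p \<in> topspace (mtop M)" by (rule open_points[OF U p])
  obtain V \<phi> where c: "(V, \<phi>) \<in> charts M" "p \<in> V" using chart_exists[OF tp] by blast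
  have tE: "E i p \<in> tangent_space M p" for i using vf_tangent[OF frameD(1)[OF E] p] .
  have "\<forall>i. \<exists>a. E i p = chart_vec V \<phi> p a"
    using tE tangent_space_chart[OF c] by blast
  then obtain a where a: "\<And>i. E i p = chart_vec V \<phi> p (a i)" by metis
  define L where "L = (\<lambda>x::real^'n. \<Sum>i\<in>UNIV. x $ i *\<^sub>R a i)"
  have linL: "linear L"
    unfolding L_def by (intro linear_compose_sum) (auto intro!: linearI simp: algebra_simps)
  have z: "chart_vec V \<phi> p 0 = (\<lambda>u. 0)" using chart_vec_lin[OF c, of 0 0 0 0] by simp
  have "chart_vec V \<phi> p (\<Sum>i\<in>I. x $ i *\<^sub>R a i) = (\<lambda>u. \<Sum>i\<in>I. x $ i * E i p u)" for x :: "real^'n" and I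
  proof (induction I rule: infinite_finite_induct)
    case (insert j I)
    then show ?case using chart_vec_lin[OF c, of "x $ j" "a j" 1] by (simp add: a)
  qed (simp_all add: z)
  then have L: "chart_vec V \<phi> p (L x) = (\<lambda>u. \<Sum>i\<in>UNIV. x $ i * E i p u)" for x unfolding L_def .
  have gL: "g p (chart_vec V \<phi> p (L x)) (E j p) = x $ j" for x j
  proof -
    have "g p (chart_vec V \<phi> p (L x)) (E j p) = (\<Sum>i\<in>UNIV. x $ i * g p (E i p) (E j p))"
      unfolding L by (intro g_sum tp tE)
    also have "\<dots> = (\<Sum>i\<in>UNIV. if i = j then x $ j else 0)"
      by (intro sum.cong) (auto simp: frameD(2)[OF E p])
    finally show ?thesis by simp
  qed
  have "x = 0" if "L x = 0" for x
    using gL[of x] that z g_zero[OF tp tE] by (simp add: vec_eq_iff)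
  then have "surj L"
    using linear_injective_0[OF linL] linear_injective_imp_surjective[OF linL] by blast
  moreover obtain b where b: "v = chart_vec V \<phi> p b" using v tangent_space_chart[OF c] by blast
  ultimately obtain x where x: "v = chart_vec V \<phi> p (L x)" by (metis surjD)
  have "g p v (E i p) = x $ i" for i using gL[of x i] by (simp only: x)
  moreover have "v = (\<lambda>u. \<Sum>i\<in>UNIV. x $ i * E i p u)" using L[of x] by (simp only: x)
  ultimately show ?thesis by (simp only:)
qed

lemma parseval:
  assumes U: "opn U" and E: "orthonormal_frame M g U E" and p: "p \<in> U"
    and v: "v \<in> tangent_space M p" and w: "w \<in> tangent_space M p"
  shows "g p v w = (\<Sum>i\<in>UNIV. g p v (E i p) * g p (E i p) w)"
proof -
  have "g p v w = g p (\<lambda>u. \<Sum>i\<in>UNIV. g p v (E i p) * E i p u) w"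
    using frame_expand_at[OF U E p v] by simp
  also have "\<dots> = (\<Sum>i\<in>UNIV. g p v (E i p) * g p (E i p) w)"
    by (intro g_sum open_points[OF U p] w vf_tangent[OF frameD(1)[OF E] p])
  finally show ?thesis .
qed

text \<open>The arguments of \<open>F\<close> are germs of vector fields at \<open>q\<close>; its value stands for the value at \<open>q\<close>
  of a tensor, in one of its arguments.\<close>

definition tensorial :: "'a set \<Rightarrow> 'a \<Rightarrow> ('a vfield \<Rightarrow> real) \<Rightarrow> bool" where
  "tensorial U q F \<longleftrightarrow> (\<forall>W. opn W \<and> q \<in> W \<and> W \<subseteq> U \<longrightarrow>
     (\<forall>X\<in>VF W. \<forall>Y\<in>VF W. F (\<lambda>p u. X p u + Y p u) = F X + F Y) \<and>
     (\<forall>X\<in>VF W. \<forall>a. smooth_fun M W a \<longrightarrow> F (\<lambda>p u. a p * X p u) = a q * F X) \<and>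
     (\<forall>X\<in>VF W. \<forall>Y\<in>VF W. (\<forall>p\<in>W. X p = Y p) \<longrightarrow> F X = F Y))"

lemma tensorialI:
  assumes "\<And>W X Y. opn W \<Longrightarrow> q \<in> W \<Longrightarrow> W \<subseteq> U \<Longrightarrow> X \<in> VF W \<Longrightarrow> Y \<in> VF W \<Longrightarrow>
      F (\<lambda>p u. X p u + Y p u) = F X + F Y"
    and "\<And>W X a. opn W \<Longrightarrow> q \<in> W \<Longrightarrow> W \<subseteq> U \<Longrightarrow> X \<in> VF W \<Longrightarrow> smooth_fun M W a \<Longrightarrow>
      F (\<lambda>p u. a p * X p u) = a q * F X"
    and "\<And>W X Y. opn W \<Longrightarrow> q \<in> W \<Longrightarrow> W \<subseteq> U \<Longrightarrow> X \<in> VF W \<Longrightarrow> Y \<in> VF W \<Longrightarrow>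
      (\<And>p. p \<in> W \<Longrightarrow> X p = Y p) \<Longrightarrow> F X = F Y"
  shows "tensorial U q F"
  unfolding tensorial_def
proof (intro allI impI conjI ballI)
  fix W X Y assume "opn W \<and> q \<in> W \<and> W \<subseteq> U" and XY: "X \<in> VF W" "Y \<in> VF W"
  then have W: "opn W" "q \<in> W" "W \<subseteq> U" by auto
  show "F (\<lambda>p u. X p u + Y p u) = F X + F Y" by (rule assms(1)[OF W XY])
  show "F X = F Y" if "\<forall>p\<in>W. X p = Y p" by (rule assms(3)[OF W XY]) (use that in blast)
next
  fix W X a assume "opn W \<and> q \<in> W \<and> W \<subseteq> U" and X: "X \<in> VF W" "smooth_fun M W a"
  then have W: "opn W" "q \<in> W" "W \<subseteq> U" by auto
  show "F (\<lambda>p u. a p * X p u) = a q * F X" by (rule assms(2)[OF W X])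
qed

text \<open>Function-linearity is available on every smaller neighbourhood \<open>W\<close> because
  fields on \<open>W\<close> are not assumed to extend to \<open>U\<close>, and the coefficients of
  the expansion live on \<open>W\<close> only. It follows that \<open>F X\<close> depends on
  \<open>X\<close> only through the value \<open>X q\<close>.\<close>

lemma tensorial_expand:
  assumes F: "tensorial U q F" and W: "opn W" "q \<in> W" "W \<subseteq> U"
    and E: "orthonormal_frame M g W E" and X: "X \<in> VF W"
  shows "F X = (\<Sum>i\<in>UNIV. g q (X q) (E i q) * F (E i))"
proof -
  note FW = F[unfolded tensorial_def, THEN spec, THEN mp, OF conjI[OF W(1) conjI[OF W(2,3)]]]
  have add: "F (\<lambda>p u. X p u + Y p u) = F X + F Y" if "X \<in> VF W" "Y \<in> VF W" for X Y
    using FW[THEN conjunct1, rule_format] that .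
  have scale: "F (\<lambda>p u. a p * X p u) = a q * F X" if "X \<in> VF W" "smooth_fun M W a" for X a
    using FW[THEN conjunct2, THEN conjunct1, rule_format] that .
  have cong: "F X = F Y" if "X \<in> VF W" "Y \<in> VF W" "\<And>p. p \<in> W \<Longrightarrow> X p = Y p" for X Y
    using FW[THEN conjunct2, THEN conjunct2, rule_format, OF that(1,2)] that(3) .
  let ?a = "\<lambda>i p. g p (X p) (E i p)"
  have a: "smooth_fun M W (?a i)" for i by (rule g_smooth[OF W(1) X frameD(1)[OF E]])
  have sum: "F (\<lambda>p u. \<Sum>i\<in>I. ?a i p * E i p u) = (\<Sum>i\<in>I. ?a i q * F (E i))" for I
  proof (induction I rule: infinite_finite_induct)
    case (insert j I)
    have "F (\<lambda>p u. \<Sum>i\<in>insert j I. ?a i p * E i p u) =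
        F (\<lambda>p u. ?a j p * E j p u + (\<Sum>i\<in>I. ?a i p * E i p u))"
      using insert.hyps by simp
    also have "\<dots> = F (\<lambda>p u. ?a j p * E j p u) + F (\<lambda>p u. \<Sum>i\<in>I. ?a i p * E i p u)"
      by (intro add vf_scale[OF a frameD(1)[OF E]] vf_sum[OF W(1) a frameD(1)[OF E]])
    also have "F (\<lambda>p u. ?a j p * E j p u) = ?a j q * F (E j)"
      by (rule scale[OF frameD(1)[OF E] a])
    finally show ?case using insert by simp
  qed (use scale[OF X smooth_fun_const[OF W(1), of 0]] in simp_all)
  have "F X = F (\<lambda>p u. \<Sum>i\<in>UNIV. ?a i p * E i p u)"
    using frame_expand_at[OF W(1) E _ vf_tangent[OF X]]
    by (intro cong[OF X vf_sum[OF W(1) a frameD(1)[OF E]]]) auto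
  then show ?thesis using sum by simp
qed

lemma frame_subset: "orthonormal_frame M g U E \<Longrightarrow> W \<subseteq> U \<Longrightarrow> orthonormal_frame M g W E"
  unfolding orthonormal_frame_def using vf_subset by blast

text \<open>A change of orthonormal frame is an orthogonal matrix, under which a trace is invariant.
  The need arises from \<open>frame_at\<close>, which chooses its frame anew at each point.\<close>

lemma trace_frame_indep:
  assumes U: "opn U" "q \<in> U" and E: "orthonormal_frame M g U E" and E': "orthonormal_frame M g U E'"
    and B1: "\<And>Y. Y \<in> VF U \<Longrightarrow> tensorial U q (\<lambda>X. B X Y)"
    and B2: "\<And>X. X \<in> VF U \<Longrightarrow> tensorial U q (\<lambda>Y. B X Y)"
  shows "(\<Sum>i\<in>UNIV. B (E' i) (E' i)) = (\<Sum>i\<in>UNIV. B (E i) (E i))"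
proof -
  let ?a = "\<lambda>i k. g q (E' i q) (E k q)"
  note vE = frameD(1)[OF E] and vE' = frameD(1)[OF E']
  have "B (E' i) (E' i) = (\<Sum>k\<in>UNIV. \<Sum>l\<in>UNIV. (?a i k * ?a i l) * B (E k) (E l))" for i
    unfolding tensorial_expand[OF B1[OF vE'] U subset_refl E vE', of i i]
      tensorial_expand[OF B2[OF vE] U subset_refl E vE', of _ i]
    by (simp add: sum_distrib_left mult.assoc)
  then have "(\<Sum>i\<in>UNIV. B (E' i) (E' i)) =
      (\<Sum>i\<in>UNIV. \<Sum>k\<in>UNIV. \<Sum>l\<in>UNIV. (?a i k * ?a i l) * B (E k) (E l))" by simp
  also have "\<dots> = (\<Sum>k\<in>UNIV. \<Sum>i\<in>UNIV. \<Sum>l\<in>UNIV. (?a i k * ?a i l) * B (E k) (E l))"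
    by (rule sum.swap)
  also have "\<dots> = (\<Sum>k\<in>UNIV. \<Sum>l\<in>UNIV. \<Sum>i\<in>UNIV. (?a i k * ?a i l) * B (E k) (E l))"
    by (intro sum.cong refl sum.swap)
  also have "\<dots> = (\<Sum>k\<in>UNIV. \<Sum>l\<in>UNIV. (\<Sum>i\<in>UNIV. ?a i k * ?a i l) * B (E k) (E l))"
    by (simp add: sum_distrib_right)
  also have "\<dots> = (\<Sum>k\<in>UNIV. \<Sum>l\<in>UNIV. (if k = l then 1 else 0) * B (E k) (E l))"
  proof (intro sum.cong refl)
    fix k l
    \<comment> \<open>Parseval with respect to \<open>E'\<close> says that the columns of the
      transition matrix are orthonormal.\<close>
    have "g q (E k q) (E l q) = (\<Sum>i\<in>UNIV. g q (E k q) (E' i q) * g q (E' i q) (E l q))"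
      using parseval[OF U(1) E' U(2) vf_tangent[OF vE U(2)] vf_tangent[OF vE U(2)]] .
    also have "\<dots> = (\<Sum>i\<in>UNIV. ?a i k * ?a i l)"
      using g_sym[OF U vE vE'] by simp
    finally show "(\<Sum>i\<in>UNIV. ?a i k * ?a i l) * B (E k) (E l) = (if k = l then 1 else 0) * B (E k) (E l)"
      using frameD(2)[OF E U(2)] by simp
  qed
  also have "\<dots> = (\<Sum>k\<in>UNIV. \<Sum>l\<in>UNIV. if k = l then B (E k) (E l) else 0)"
    by (intro sum.cong refl) simp
  finally show ?thesis by simp
qed

end


section \<open>Connection and curvature\<close>

locale levi_civita_loc = riemannian_loc M g for M :: "('a, 'n::finite) manifold" and g +
  fixes D :: "'a connection"
  assumes levi_civita: "levi_civita_connection M g D"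
begin

abbreviation br :: "'a vfield \<Rightarrow> 'a vfield \<Rightarrow> 'a vfield" where "br \<equiv> lie_bracket M"
abbreviation R :: "'a vfield \<Rightarrow> 'a vfield \<Rightarrow> 'a vfield \<Rightarrow> 'a vfield" where "R \<equiv> curvature M D"

lemmas affine_laws = levi_civita[unfolded levi_civita_connection_def, THEN conjunct1,
    unfolded affine_connection_def, THEN spec, THEN mp]

lemmas D_vf = affine_laws[THEN conjunct1, rule_format]

lemma D_cong:
  assumes "opn U" "X \<in> VF U" "Y \<in> VF U" "X' \<in> VF U" "Y' \<in> VF U"
    "\<And>p. p \<in> U \<Longrightarrow> X p = X' p" "\<And>p. p \<in> U \<Longrightarrow> Y p = Y' p" "q \<in> U"
  shows "D X Y q = D X' Y' q"
  by (rule affine_laws[THEN conjunct2, THEN conjunct1, rule_format, OF assms(1-5) _ assms(8)])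
    (simp add: assms(6,7))

lemma D_lin1:
  assumes "opn U" "X \<in> VF U" "Y \<in> VF U" "Z \<in> VF U" "smooth_fun M U a" "smooth_fun M U b" "q \<in> U"
  shows "D (\<lambda>p u. a p * X p u + b p * Y p u) Z q = (\<lambda>u. a q * D X Z q u + b q * D Y Z q u)"
  by (rule affine_laws[THEN conjunct2, THEN conjunct2, THEN conjunct1, unfolded lin_comb_def,
        rule_format, OF assms(1-4) conjI[OF assms(5,6)] assms(7)])

lemmas D_add2 = affine_laws[THEN conjunct2, THEN conjunct2, THEN conjunct2, THEN conjunct1, rule_format]

lemmas D_leibniz = affine_laws[THEN conjunct2, THEN conjunct2, THEN conjunct2, THEN conjunct2, rule_format]

lemma torsion: "opn U \<Longrightarrow> X \<in> VF U \<Longrightarrow> Y \<in> VF U \<Longrightarrow> q \<in> U \<Longrightarrow>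
    br X Y q = (\<lambda>u. D X Y q u - D Y X q u)"
  by (rule sym) (use levi_civita in \<open>unfold levi_civita_connection_def torsion_free_def, blast\<close>)

lemma compat: "opn U \<Longrightarrow> X \<in> VF U \<Longrightarrow> Y \<in> VF U \<Longrightarrow> Z \<in> VF U \<Longrightarrow> q \<in> U \<Longrightarrow>
    X q (\<lambda>r. g r (Y r) (Z r)) = g q (D X Y q) (Z q) + g q (Y q) (D X Z q)"
  using levi_civita unfolding levi_civita_connection_def metric_compatible_def by blast

lemma D_add1: "opn U \<Longrightarrow> X \<in> VF U \<Longrightarrow> Y \<in> VF U \<Longrightarrow> Z \<in> VF U \<Longrightarrow> q \<in> U \<Longrightarrow>
    D (\<lambda>p u. X p u + Y p u) Z q = (\<lambda>u. D X Z q u + D Y Z q u)"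
  using D_lin1[of U X Y Z "\<lambda>p. 1" "\<lambda>p. 1" q] smooth_fun_const[of U] by simp

lemma D_diff1: "opn U \<Longrightarrow> X \<in> VF U \<Longrightarrow> Y \<in> VF U \<Longrightarrow> Z \<in> VF U \<Longrightarrow> q \<in> U \<Longrightarrow>
    D (\<lambda>p u. X p u - Y p u) Z q = (\<lambda>u. D X Z q u - D Y Z q u)"
  using D_lin1[of U X Y Z "\<lambda>p. 1" "\<lambda>p. -1" q] smooth_fun_const[of U] by simp

lemma D_scale1: "opn U \<Longrightarrow> X \<in> VF U \<Longrightarrow> Z \<in> VF U \<Longrightarrow> smooth_fun M U a \<Longrightarrow> q \<in> U \<Longrightarrow>
    D (\<lambda>p u. a p * X p u) Z q = (\<lambda>u. a q * D X Z q u)"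
  using D_lin1[of U X X Z a "\<lambda>p. 0" q] smooth_fun_const[of U] by simp

lemma D_minus2: "opn U \<Longrightarrow> X \<in> VF U \<Longrightarrow> Y \<in> VF U \<Longrightarrow> q \<in> U \<Longrightarrow>
    D X (\<lambda>p u. - Y p u) q = (\<lambda>u. - D X Y q u)"
  using D_leibniz[of U X Y "\<lambda>p. -1" q] smooth_fun_const[of U] der_const[of U X q "-1"] by simp

lemma vf_minus: "opn U \<Longrightarrow> X \<in> VF U \<Longrightarrow> (\<lambda>p u. - X p u) \<in> VF U"
  using vf_scale[OF smooth_fun_const[of U "-1"]] by simp

lemma D_diff2: "opn U \<Longrightarrow> X \<in> VF U \<Longrightarrow> Y \<in> VF U \<Longrightarrow> Z \<in> VF U \<Longrightarrow> q \<in> U \<Longrightarrow>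
    D X (\<lambda>p u. Y p u - Z p u) q = (\<lambda>u. D X Y q u - D X Z q u)"
  using D_add2[of U X Y "\<lambda>p u. - Z p u" q] D_minus2[of U X Z q] vf_minus[of U Z] by simp

text \<open>A direct proof would compute with second derivatives in a chart. Vanishing torsion
  presents the bracket as a difference of two covariant derivatives, which are vector fields
  already.\<close>

lemma br_vf:
  assumes U: "opn U" and X: "X \<in> VF U" and Y: "Y \<in> VF U" shows "br X Y \<in> VF U"
  by (rule vf_cong[OF vf_diff[OF U D_vf[OF U X Y] D_vf[OF U Y X]]]) (rule torsion[OF U X Y])

lemma br_apply: "q \<in> U \<Longrightarrow> smooth_fun M U u \<Longrightarrow>
    br X Y q u = X q (\<lambda>p. Y p u) - Y q (\<lambda>p. X p u)"
  unfolding lie_bracket_def using smooth_nearI by auto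

lemma br_swap: "br Y X = (\<lambda>p u. - br X Y p u)"
  unfolding lie_bracket_def by (intro ext) simp

section \<open>The curvature operator and the tensorial expressions to be traced\<close>

lemma R_vf: assumes U: "opn U" and X: "X \<in> VF U" and Y: "Y \<in> VF U" and Z: "Z \<in> VF U"
  shows "R X Y Z \<in> VF U"
  unfolding curvature_def by (intro vf_diff D_vf br_vf assms)

lemma R_swap:
  assumes U: "opn U" and X: "X \<in> VF U" and Y: "Y \<in> VF U" and Z: "Z \<in> VF U" and q: "q \<in> U"
  shows "R Y X Z q = (\<lambda>u. - R X Y Z q u)"
proof -
  have "D (br Y X) Z q = (\<lambda>u. - D (br X Y) Z q u)"
    unfolding br_swap[of Y X]
    using D_scale1[OF U br_vf[OF U X Y] Z smooth_fun_const[OF U, of "-1"] q] by simp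
  then show ?thesis unfolding curvature_def by (simp add: fun_eq_iff)
qed

lemma R_add1:
  assumes U: "opn U" and "X \<in> VF U" "X' \<in> VF U" "Y \<in> VF U" "Z \<in> VF U" "q \<in> U"
  shows "R (\<lambda>p u. X p u + X' p u) Y Z q = (\<lambda>u. R X Y Z q u + R X' Y Z q u)"
proof -
  note vf = assms(2-5) D_vf[OF U] vf_add[OF U] vf_diff[OF U] br_vf[OF U]
  let ?S = "\<lambda>p u. X p u + X' p u"
  have br: "br ?S Y r = (\<lambda>u. br X Y r u + br X' Y r u)" if "r \<in> U" for r
    using vf that by (simp add: torsion[OF U] D_add1[OF U] D_add2[OF U] fun_eq_iff)
  have "D (br ?S Y) Z q = D (\<lambda>r u. br X Y r u + br X' Y r u) Z q"
    by (intro D_cong[OF U]) (simp_all add: vf br assms)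
  also have "\<dots> = (\<lambda>u. D (br X Y) Z q u + D (br X' Y) Z q u)"
    using vf assms by (simp add: D_add1[OF U])
  finally have 1: "D (br ?S Y) Z q = \<dots>" .
  have "D Y (D ?S Z) q = D Y (\<lambda>r u. D X Z r u + D X' Z r u) q"
    by (intro D_cong[OF U]) (simp_all add: vf assms D_add1[OF U])
  also have "\<dots> = (\<lambda>u. D Y (D X Z) q u + D Y (D X' Z) q u)"
    using vf assms by (simp add: D_add2[OF U])
  finally have 2: "D Y (D ?S Z) q = \<dots>" .
  show ?thesis unfolding curvature_def
    by (simp add: 1 2 D_add1[OF U] vf assms fun_eq_iff)
qed

text \<open>The derivative of \<open>a\<close> enters twice, through the Leibniz rule for
  \<open>D Y\<close> and through the bracket, and the two terms \<open>Y q a * D X Z q u\<close>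
  cancel.\<close>

lemma R_scale1:
  assumes U: "opn U" and "X \<in> VF U" "Y \<in> VF U" "Z \<in> VF U" "q \<in> U" and a: "smooth_fun M U a"
  shows "R (\<lambda>p u. a p * X p u) Y Z q = (\<lambda>u. a q * R X Y Z q u)"
proof -
  note sm = a vf_smooth[OF assms(3) a subset_refl]
  note vf = assms(2-4) D_vf[OF U] vf_scale vf_diff[OF U] br_vf[OF U] vf_add[OF U]
  let ?S = "\<lambda>p u. a p * X p u"
  have br: "br ?S Y r = (\<lambda>u. a r * br X Y r u - Y r a * X r u)" if "r \<in> U" for r
    using vf sm that by (simp add: torsion[OF U] D_scale1[OF U] D_leibniz[OF U] algebra_simps)
  have "D (br ?S Y) Z q = D (\<lambda>r u. a r * br X Y r u - Y r a * X r u) Z q"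
    by (intro D_cong[OF U]) (simp_all add: vf sm br assms)
  also have "\<dots> = (\<lambda>u. D (\<lambda>r u. a r * br X Y r u) Z q u - D (\<lambda>r u. Y r a * X r u) Z q u)"
    by (intro D_diff1[OF U] vf sm assms)
  also have "\<dots> = (\<lambda>u. a q * D (br X Y) Z q u - Y q a * D X Z q u)"
    using vf sm assms D_scale1[OF U br_vf[OF U assms(2,3)] assms(4) a assms(5)]
      D_scale1[OF U assms(2) assms(4) sm(2) assms(5)] by simp
  finally have 1: "D (br ?S Y) Z q = \<dots>" .
  have "D Y (D ?S Z) q = D Y (\<lambda>r u. a r * D X Z r u) q"
    by (intro D_cong[OF U]) (simp_all add: vf sm assms D_scale1[OF U])
  also have "\<dots> = (\<lambda>u. a q * D Y (D X Z) q u + Y q a * D X Z q u)"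
    using vf sm assms by (simp add: D_leibniz[OF U])
  finally have 2: "D Y (D ?S Z) q = \<dots>" .
  show ?thesis unfolding curvature_def
    by (simp add: 1 2 D_scale1[OF U] vf sm assms algebra_simps)
qed

lemma R_cong1:
  assumes U: "opn U" and "X \<in> VF U" "X' \<in> VF U" "Y \<in> VF U" "Z \<in> VF U" "q \<in> U"
    and eq: "\<And>p. p \<in> U \<Longrightarrow> X p = X' p"
  shows "R X Y Z q = R X' Y Z q"
proof -
  note vf = assms(2-5) D_vf[OF U] br_vf[OF U]
  have d: "D X W r = D X' W r" "D W X r = D W X' r" if "W \<in> VF U" "r \<in> U" for W r
    using D_cong[OF U vf(1) that(1) vf(2) that(1) eq refl that(2)]
      D_cong[OF U that(1) vf(1) that(1) vf(2) refl eq that(2)] by simp_all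
  have "br X Y r = br X' Y r" if "r \<in> U" for r using vf that by (simp add: torsion[OF U] d)
  then have "D (br X Y) Z q = D (br X' Y) Z q"
    by (intro D_cong[OF U]) (simp_all add: vf assms)
  moreover have "D Y (D X Z) q = D Y (D X' Z) q"
    by (intro D_cong[OF U]) (simp_all add: vf assms d)
  ultimately show ?thesis unfolding curvature_def by (simp add: d vf assms)
qed

lemma tensorial_D:
  assumes "opn U" "q \<in> U" "Z \<in> VF U" "z \<in> tangent_space M q"
  shows "tensorial U q (\<lambda>X. g q (D X Z q) z)"
proof (rule tensorialI)
  have tq: "q \<in> topspace (mtop M)" using open_points assms by blast
  fix W X Y a assume W: "opn W" "q \<in> W" "W \<subseteq> U" and X: "X \<in> VF W"
  have Z: "Z \<in> VF W" using vf_subset assms W by blast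
  note vf = X Z D_vf[OF W(1)] vf_tangent[OF _ W(2)]
  show "g q (D (\<lambda>p u. a p * X p u) Z q) z = a q * g q (D X Z q) z" if "smooth_fun M W a"
    using vf that W assms(4) by (simp add: D_scale1[OF W(1)] g_scale1[OF tq])
  assume Y: "Y \<in> VF W"
  show "g q (D (\<lambda>p u. X p u + Y p u) Z q) z = g q (D X Z q) z + g q (D Y Z q) z"
    using vf Y W assms(4) by (simp add: D_add1[OF W(1)] g_add1[OF tq])
  show "g q (D X Z q) z = g q (D Y Z q) z" if "\<And>p. p \<in> W \<Longrightarrow> X p = Y p"
    using D_cong[OF W(1) X Z Y Z that] W by simp
qed

lemma tensorial_R:
  assumes "opn U" "q \<in> U" "Y \<in> VF U" "Z \<in> VF U" "z \<in> tangent_space M q"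
  shows "tensorial U q (\<lambda>X. g q (R X Y Z q) z)"
proof (rule tensorialI)
  have tq: "q \<in> topspace (mtop M)" using open_points assms by blast
  fix W X X' a assume W: "opn W" "q \<in> W" "W \<subseteq> U" and X: "X \<in> VF W"
  have YZ: "Y \<in> VF W" "Z \<in> VF W" using vf_subset assms W by blast+
  note vf = X YZ R_vf[OF W(1)] vf_tangent[OF _ W(2)]
  show "g q (R (\<lambda>p u. a p * X p u) Y Z q) z = a q * g q (R X Y Z q) z" if "smooth_fun M W a"
    using vf that W assms(5) by (simp add: R_scale1[OF W(1)] g_scale1[OF tq])
  assume Y: "X' \<in> VF W"
  show "g q (R (\<lambda>p u. X p u + X' p u) Y Z q) z = g q (R X Y Z q) z + g q (R X' Y Z q) z"
    using vf Y W assms(5) by (simp add: R_add1[OF W(1)] g_add1[OF tq])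
  show "g q (R X Y Z q) z = g q (R X' Y Z q) z" if "\<And>p. p \<in> W \<Longrightarrow> X p = X' p"
    using R_cong1[OF W(1) X Y YZ W(2) that] by simp
qed

lemma tensorial_g:
  assumes "opn U" "q \<in> U" "v \<in> tangent_space M q"
  shows "tensorial U q (\<lambda>Y. g q v (Y q))"
proof (rule tensorialI)
  have tq: "q \<in> topspace (mtop M)" using open_points assms by blast
  fix W X Y a assume W: "opn W" "q \<in> W" "W \<subseteq> U" and X: "X \<in> VF W"
  note tX = vf_tangent[OF X W(2)]
  show "g q v (\<lambda>u. a q * X q u) = a q * g q v (X q)"
    using g_lin2[OF tq tX tX assms(3), of "a q" 0] by simp
  assume Y: "Y \<in> VF W"
  show "g q v (\<lambda>u. X q u + Y q u) = g q v (X q) + g q v (Y q)"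
    using g_lin2[OF tq tX vf_tangent[OF Y W(2)] assms(3), of 1 1] by simp
  show "g q v (X q) = g q v (Y q)" if "\<And>p. p \<in> W \<Longrightarrow> X p = Y p" using that W by simp
qed

text \<open>The matrix of the numbers \<open>g q (D V (E i) q) (E k q)\<close> is skew because the
  products of the frame fields are constant. It is paired here with the symmetric expression
  \<open>B (E k) (E i) + B (E i) (E k)\<close>. Hence a trace is differentiated as if the frame were
  parallel.\<close>

lemma trace_deriv_zero:
  assumes U: "opn U" and q: "q \<in> U" and E: "orthonormal_frame M g U E" and V: "V \<in> VF U"
    and B1: "\<And>Y. Y \<in> VF U \<Longrightarrow> tensorial U q (\<lambda>X. B X Y)"
    and B2: "\<And>X. X \<in> VF U \<Longrightarrow> tensorial U q (\<lambda>Y. B X Y)"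
  shows "(\<Sum>i\<in>UNIV. B (D V (E i)) (E i) + B (E i) (D V (E i))) = 0"
proof -
  let ?w = "\<lambda>i k. g q (D V (E i) q) (E k q)"
  note vE = frameD(1)[OF E]
  note vD = D_vf[OF U V vE]
  have anti: "?w k i = - ?w i k" for i k
  proof -
    have "V q (\<lambda>r. g r (E i r) (E k r)) = V q (\<lambda>r. if i = k then 1 else 0)"
      by (rule der_cong[OF U V q]) (simp add: frameD(2)[OF E])
    then have "g q (D V (E i) q) (E k q) + g q (E i q) (D V (E k) q) = 0"
      using compat[OF U V vE vE q, of i k] der_const[OF U V q] by simp
    then show ?thesis using g_sym[OF U q vE vD, of i k] by simp
  qed
  have "(\<Sum>i\<in>UNIV. B (D V (E i)) (E i) + B (E i) (D V (E i))) =
      (\<Sum>i\<in>UNIV. \<Sum>k\<in>UNIV. ?w i k * B (E k) (E i)) + (\<Sum>i\<in>UNIV. \<Sum>k\<in>UNIV. ?w i k * B (E i) (E k))"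
    unfolding sum.distrib
    using tensorial_expand[OF B1[OF vE] U q subset_refl E vD]
      tensorial_expand[OF B2[OF vE] U q subset_refl E vD] by simp
  also have "(\<Sum>i\<in>UNIV. \<Sum>k\<in>UNIV. ?w i k * B (E i) (E k)) =
      (\<Sum>k\<in>UNIV. \<Sum>i\<in>UNIV. ?w i k * B (E i) (E k))" by (rule sum.swap)
  also have "\<dots> = - (\<Sum>i\<in>UNIV. \<Sum>k\<in>UNIV. ?w i k * B (E k) (E i))"
    by (subst anti) (simp add: sum_negf)
  finally show ?thesis by simp
qed

section \<open>The covariant curvature tensor, the Ricci tensor and the Bianchi identities\<close>

definition Rm :: "'a vfield \<Rightarrow> 'a vfield \<Rightarrow> 'a vfield \<Rightarrow> 'a vfield \<Rightarrow> 'a \<Rightarrow> real" where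
  "Rm X Y Z W q = g q (R X Y Z q) (W q)"

lemma Rm_smooth: "opn U \<Longrightarrow> X \<in> VF U \<Longrightarrow> Y \<in> VF U \<Longrightarrow> Z \<in> VF U \<Longrightarrow> W \<in> VF U \<Longrightarrow>
    smooth_fun M U (Rm X Y Z W)"
  unfolding Rm_def by (intro g_smooth R_vf)

lemma Rm_swap12:
  assumes U: "opn U" and "X \<in> VF U" "Y \<in> VF U" "Z \<in> VF U" "W \<in> VF U" "q \<in> U"
  shows "Rm Y X Z W q = - Rm X Y Z W q"
  using g_scale1[OF open_points[OF U assms(6)] vf_tangent[OF R_vf[OF U assms(2-4)] assms(6)]
      vf_tangent[OF assms(5,6)], of "-1"]
  by (simp add: Rm_def R_swap[OF U assms(2-4,6)])

text \<open>Second derivatives of the function \<open>?h\<close>, the product of \<open>Z\<close>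
  and \<open>W\<close>, commute up to the bracket. Metric compatibility turns this into
  \<open>Rm X Y Z W q + Rm X Y W Z q = 0\<close>: the mixed products of first derivatives are
  symmetric in \<open>X\<close> and \<open>Y\<close> and drop out.\<close>

lemma Rm_swap34:
  assumes U: "opn U" and "X \<in> VF U" "Y \<in> VF U" "Z \<in> VF U" "W \<in> VF U" "q \<in> U"
  shows "Rm X Y W Z q = - Rm X Y Z W q"
proof -
  note vf = assms(2-5) D_vf[OF U] br_vf[OF U] vf_diff[OF U]
  note tg = vf_tangent[OF _ assms(6)]
  have tq: "q \<in> topspace (mtop M)" using open_points[OF U assms(6)] .
  let ?h = "\<lambda>r. g r (Z r) (W r)"
  have h: "smooth_fun M U ?h" by (intro g_smooth U vf)
  have second: "A q (\<lambda>r. B r ?h) = g q (D A (D B Z) q) (W q) + g q (D B Z q) (D A W q)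
      + g q (D A Z q) (D B W q) + g q (Z q) (D A (D B W) q)"
    if A: "A \<in> VF U" and B: "B \<in> VF U" for A B
  proof -
    have "A q (\<lambda>r. B r ?h) = A q (\<lambda>r. g r (D B Z r) (W r) + g r (Z r) (D B W r))"
      by (intro der_cong[OF U A assms(6)]) (simp add: compat[OF U] B vf)
    also have "\<dots> = A q (\<lambda>r. g r (D B Z r) (W r)) + A q (\<lambda>r. g r (Z r) (D B W r))"
      by (intro der_add[OF U A assms(6)] g_smooth U vf B)
    finally show ?thesis using compat[OF U] A B vf assms(6) by simp
  qed
  have "br X Y q ?h = X q (\<lambda>r. Y r ?h) - Y q (\<lambda>r. X r ?h)"
    by (rule br_apply[OF assms(6) h])
  moreover have "br X Y q ?h = g q (D (br X Y) Z q) (W q) + g q (Z q) (D (br X Y) W q)"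
    by (intro compat[OF U] vf assms)
  moreover have "Rm X Y Z W q = g q (D X (D Y Z) q) (W q) - g q (D Y (D X Z) q) (W q)
      - g q (D (br X Y) Z q) (W q)"
    unfolding Rm_def curvature_def by (simp add: g_diff1[OF tq] tangent_diff[OF tq] tg vf)
  moreover have "Rm X Y W Z q = g q (D X (D Y W) q) (Z q) - g q (D Y (D X W) q) (Z q)
      - g q (D (br X Y) W q) (Z q)"
    unfolding Rm_def curvature_def by (simp add: g_diff1[OF tq] tangent_diff[OF tq] tg vf)
  moreover have "g q (A q) (Z q) = g q (Z q) (A q)" if "A \<in> VF U" for A
    using g_sym[OF U assms(6)] that vf by blast
  ultimately show ?thesis using second[OF assms(2,3)] second[OF assms(3,2)]
    by (simp add: vf)
qed

text \<open>Each double bracket is a sum of four threefold derivatives of \<open>u\<close>, and the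
  twelve terms cancel in pairs. This needs a neighbourhood on which \<open>u\<close> is smooth; for
  other \<open>u\<close> every bracket has the default value 0.\<close>

lemma jacobi:
  assumes U: "opn U" and "X \<in> VF U" "Y \<in> VF U" "Z \<in> VF U" "q \<in> U"
  shows "br (br X Y) Z q u + br (br Y Z) X q u + br (br Z X) Y q u = 0"
proof (cases "smooth_near M q u")
  case True
  then obtain W0 where W0: "q \<in> W0" "smooth_fun M W0 u" unfolding smooth_near_def by blast
  define W where "W = U \<inter> W0"
  have W: "opn W" "q \<in> W" "W \<subseteq> U" using W0 smooth_fun_open assms by (auto simp: W_def)
  have u: "smooth_fun M W u" using W0 smooth_fun_subset[OF _ W(1)] by (auto simp: W_def)
  have vf: "X \<in> VF W" "Y \<in> VF W" "Z \<in> VF W" using assms vf_subset W by blast+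
  have s: "smooth_fun M W (\<lambda>p. A p u)" if "A \<in> VF W" for A using vf_smooth[OF that u] by simp
  have s2: "smooth_fun M W (\<lambda>p. A p (\<lambda>r. B r u))" if "A \<in> VF W" "B \<in> VF W" for A B
    using vf_smooth[OF that(1) s[OF that(2)]] by simp
  have *: "br (br A B) C q u = A q (\<lambda>p. B p (\<lambda>r. C r u)) - B q (\<lambda>p. A p (\<lambda>r. C r u))
      - C q (\<lambda>p. A p (\<lambda>r. B r u)) + C q (\<lambda>p. B p (\<lambda>r. A r u))"
    if "A \<in> VF W" "B \<in> VF W" "C \<in> VF W" for A B C
  proof -
    have "C q (\<lambda>p. br A B p u) = C q (\<lambda>p. A p (\<lambda>r. B r u) - B p (\<lambda>r. A r u))"
      by (intro der_cong[OF W(1) that(3) W(2)] br_apply[OF _ u])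
    also have "\<dots> = C q (\<lambda>p. A p (\<lambda>r. B r u)) - C q (\<lambda>p. B p (\<lambda>r. A r u))"
      by (intro der_diff[OF W(1) that(3) W(2)] s2 that)
    finally show ?thesis
      using br_apply[OF W(2) u, of "br A B" C] br_apply[OF W(2) s[OF that(3)], of A B] by simp
  qed
  show ?thesis using *[OF vf] *[OF vf(2,3,1)] *[OF vf(3,1,2)] by simp
qed (simp add: lie_bracket_def)

lemma D_jacobi:
  assumes U: "opn U" and "X \<in> VF U" "Y \<in> VF U" "Z \<in> VF U" "W \<in> VF U" "q \<in> U"
  shows "D (br (br X Y) Z) W q u + D (br (br Y Z) X) W q u + D (br (br Z X) Y) W q u = 0"
proof -
  note vf = assms(2-5) br_vf[OF U] vf_add[OF U]
  let ?a = "br (br X Y) Z" and ?b = "br (br Y Z) X" and ?c = "br (br Z X) Y"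
  have "D (\<lambda>p u. (?a p u + ?b p u) + ?c p u) W q =
      (\<lambda>u. D (\<lambda>p u. ?a p u + ?b p u) W q u + D ?c W q u)"
    by (intro D_add1[OF U] vf assms)
  also have "D (\<lambda>p u. ?a p u + ?b p u) W q = (\<lambda>u. D ?a W q u + D ?b W q u)"
    by (intro D_add1[OF U] vf assms)
  finally have "D (\<lambda>p u. (?a p u + ?b p u) + ?c p u) W q u = D ?a W q u + D ?b W q u + D ?c W q u"
    by simp
  moreover have "D (\<lambda>p u. (?a p u + ?b p u) + ?c p u) W q = D (\<lambda>p u. 0) W q"
    using jacobi[OF U assms(2-4)] by (intro D_cong[OF U] vf vf_zero[OF U] assms) auto
  moreover have "D (\<lambda>p u. 0) W q = (\<lambda>u. 0)"
    using D_scale1[OF U assms(2,5) smooth_fun_const[OF U, of 0] assms(6)] by simp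
  ultimately show ?thesis by simp
qed

text \<open>The covariant derivative of the curvature operator in direction \<open>V\<close>, as
  dictated by the Leibniz rule for \<open>R X Y Z\<close>.\<close>

definition dR :: "'a vfield \<Rightarrow> 'a vfield \<Rightarrow> 'a vfield \<Rightarrow> 'a vfield \<Rightarrow> 'a vfield" where
  "dR V X Y Z = (\<lambda>p u. D V (R X Y Z) p u - R (D V X) Y Z p u - R X (D V Y) Z p u - R X Y (D V Z) p u)"

lemma R_diff1:
  assumes U: "opn U" and "X \<in> VF U" "X' \<in> VF U" "Y \<in> VF U" "Z \<in> VF U" "q \<in> U"
  shows "R (\<lambda>p u. X p u - X' p u) Y Z q u = R X Y Z q u - R X' Y Z q u"
  using R_add1[OF U assms(2) vf_minus[OF U assms(3)] assms(4-6)]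
    R_scale1[OF U assms(3-6) smooth_fun_const[OF U, of "-1"]] by simp

text \<open>Expanding everything, the threefold derivatives of \<open>Z\<close> cancel in the cyclic
  sum. Vanishing torsion combines \<open>R (D A B) C Z\<close> and \<open>R (D B A) C Z\<close> into
  a curvature term of the bracket, which absorbs the terms with one derivative along a bracket.
  Derivatives along nested brackets remain and vanish by the Jacobi identity.\<close>

lemma second_bianchi:
  assumes U: "opn U" and "V \<in> VF U" "X \<in> VF U" "Y \<in> VF U" "Z \<in> VF U" "q \<in> U"
  shows "dR V X Y Z q u + dR X Y V Z q u + dR Y V X Z q u = 0"
proof -
  note vf = assms(2-5) br_vf[OF U] D_vf[OF U] vf_diff[OF U] R_vf[OF U]
  have DR: "D A (R B C Z) q u = D A (D B (D C Z)) q u - D A (D C (D B Z)) q u - D A (D (br B C) Z) q u"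
    if "A \<in> VF U" "B \<in> VF U" "C \<in> VF U" for A B C
    unfolding curvature_def using that vf assms(6) by (simp add: D_diff2[OF U])
  have Rb: "R (D A B) C Z q u - R (D B A) C Z q u =
      D (br A B) (D C Z) q u - D C (D (br A B) Z) q u - D (br (br A B) C) Z q u"
    if "A \<in> VF U" "B \<in> VF U" "C \<in> VF U" for A B C
  proof -
    have "R (D A B) C Z q u - R (D B A) C Z q u = R (\<lambda>p u. D A B p u - D B A p u) C Z q u"
      using R_diff1[OF U, of "D A B" "D B A" C Z q u] vf that assms(6) by simp
    also have "R (\<lambda>p u. D A B p u - D B A p u) C Z q = R (br A B) C Z q"
      by (intro R_cong1[OF U]) (simp_all add: vf that assms torsion[OF U])
    finally show ?thesis by (simp add: curvature_def)
  qed
  have sw: "R A (D B C) Z q u = - R (D B C) A Z q u"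
    if "A \<in> VF U" "B \<in> VF U" "C \<in> VF U" for A B C
    using R_swap[OF U, of "D B C" A Z q] vf that assms(6) by simp
  have RD: "R A B (D C Z) q u = D A (D B (D C Z)) q u - D B (D A (D C Z)) q u - D (br A B) (D C Z) q u"
    for A B C by (simp add: curvature_def)
  show ?thesis unfolding dR_def
    using DR[OF assms(2-4)] DR[OF assms(3,4,2)] DR[OF assms(4,2,3)]
      Rb[OF assms(2-4)] Rb[OF assms(3,4,2)] Rb[OF assms(4,2,3)]
      sw[OF assms(3,2,4)] sw[OF assms(4,3,2)] sw[OF assms(2,4,3)]
      RD[of X Y V] RD[of Y V X] RD[of V X Y] D_jacobi[OF assms, of u]
    by linarith
qed

text \<open>The fully covariant form keeps both skew symmetries of \<open>Rm\<close> after
  differentiation, while \<open>dRm_eq\<close> carries the second Bianchi identity over from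
  \<open>dR\<close>. The contraction below needs all three.\<close>

definition dRm :: "'a vfield \<Rightarrow> 'a vfield \<Rightarrow> 'a vfield \<Rightarrow> 'a vfield \<Rightarrow> 'a vfield \<Rightarrow> 'a \<Rightarrow> real" where
  "dRm V X Y Z W q = V q (Rm X Y Z W) - Rm (D V X) Y Z W q - Rm X (D V Y) Z W q
     - Rm X Y (D V Z) W q - Rm X Y Z (D V W) q"

lemma dRm_eq:
  assumes U: "opn U" and "V \<in> VF U" "X \<in> VF U" "Y \<in> VF U" "Z \<in> VF U" "W \<in> VF U" "q \<in> U"
  shows "dRm V X Y Z W q = g q (dR V X Y Z q) (W q)"
proof -
  note vf = assms(2-6) D_vf[OF U] vf_diff[OF U] R_vf[OF U]
  have tq: "q \<in> topspace (mtop M)" using open_points[OF U assms(7)] .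
  have "V q (Rm X Y Z W) = g q (D V (R X Y Z) q) (W q) + g q (R X Y Z q) (D V W q)"
    unfolding Rm_def by (intro compat[OF U] vf assms)
  then show ?thesis unfolding dRm_def dR_def
    by (simp add: g_diff1[OF tq] tangent_diff[OF tq] Rm_def vf vf_tangent[OF _ assms(7)])
qed

lemma dRm_bianchi:
  assumes U: "opn U" and "V \<in> VF U" "X \<in> VF U" "Y \<in> VF U" "Z \<in> VF U" "W \<in> VF U" "q \<in> U"
  shows "dRm V X Y Z W q + dRm X Y V Z W q + dRm Y V X Z W q = 0"
proof -
  note vf = assms(2-6) D_vf[OF U] vf_diff[OF U] R_vf[OF U]
  have tq: "q \<in> topspace (mtop M)" using open_points[OF U assms(7)] .
  have t: "dR A B C Z q \<in> tangent_space M q" if "A \<in> VF U" "B \<in> VF U" "C \<in> VF U" for A B C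
    unfolding dR_def using vf that by (intro vf_tangent[OF _ assms(7)]) simp
  note t' = tangent_space_lin[OF tq _ _, of _ _ 1 1, simplified]
  have "dRm V X Y Z W q + dRm X Y V Z W q + dRm Y V X Z W q =
      g q (\<lambda>u. dR V X Y Z q u + dR X Y V Z q u + dR Y V X Z q u) (W q)"
    using assms by (simp add: dRm_eq[OF U] g_add1[OF tq] t t' vf_tangent[OF _ assms(7)])
  also have "(\<lambda>u. dR V X Y Z q u + dR X Y V Z q u + dR Y V X Z q u) = (\<lambda>u. 0)"
    using second_bianchi[OF U assms(2-5,7)] by blast
  finally show ?thesis using g_zero[OF tq vf_tangent[OF assms(6,7)]] by simp
qed

lemma dRm_swap12:
  assumes U: "opn U" and "V \<in> VF U" "X \<in> VF U" "Y \<in> VF U" "Z \<in> VF U" "W \<in> VF U" "q \<in> U"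
  shows "dRm V Y X Z W q = - dRm V X Y Z W q"
proof -
  note vf = assms(2-6) D_vf[OF U]
  have "V q (Rm Y X Z W) = V q (\<lambda>r. - Rm X Y Z W r)"
    by (intro der_cong[OF U assms(2,7)] Rm_swap12[OF U] vf)
  also have "\<dots> = - V q (Rm X Y Z W)" by (intro der_minus[OF U assms(2,7)] Rm_smooth U vf)
  finally have "V q (Rm Y X Z W) = - V q (Rm X Y Z W)" .
  moreover have "Rm (D V Y) X Z W q = - Rm X (D V Y) Z W q" "Rm Y (D V X) Z W q = - Rm (D V X) Y Z W q"
    "Rm Y X (D V Z) W q = - Rm X Y (D V Z) W q" "Rm Y X Z (D V W) q = - Rm X Y Z (D V W) q"
    by (intro Rm_swap12[OF U] vf assms)+
  ultimately show ?thesis unfolding dRm_def by linarith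
qed

lemma dRm_swap34:
  assumes U: "opn U" and "V \<in> VF U" "X \<in> VF U" "Y \<in> VF U" "Z \<in> VF U" "W \<in> VF U" "q \<in> U"
  shows "dRm V X Y W Z q = - dRm V X Y Z W q"
proof -
  note vf = assms(2-6) D_vf[OF U]
  have "V q (Rm X Y W Z) = V q (\<lambda>r. - Rm X Y Z W r)"
    by (intro der_cong[OF U assms(2,7)] Rm_swap34[OF U] vf)
  also have "\<dots> = - V q (Rm X Y Z W)" by (intro der_minus[OF U assms(2,7)] Rm_smooth U vf)
  finally have "V q (Rm X Y W Z) = - V q (Rm X Y Z W)" .
  moreover have "Rm (D V X) Y W Z q = - Rm (D V X) Y Z W q" "Rm X (D V Y) W Z q = - Rm X (D V Y) Z W q"
    "Rm X Y (D V W) Z q = - Rm X Y Z (D V W) q" "Rm X Y W (D V Z) q = - Rm X Y (D V Z) W q"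
    by (intro Rm_swap34[OF U] vf assms)+
  ultimately show ?thesis unfolding dRm_def by linarith
qed


text \<open>\<open>ricci\<close> unfolds to the frame chosen at \<open>q\<close>. Both frames live
  on the intersection of their domains, where the trace does not depend on the choice. With one
  frame for all \<open>q\<close> in \<open>U\<close>, the Ricci tensor can be
  differentiated.\<close>

lemma ricci_frame:
  assumes U: "opn U" "q \<in> U" and E: "orthonormal_frame M g U E" and Y: "Y \<in> VF U" and Z: "Z \<in> VF U"
  shows "ricci M g D Y Z q = (\<Sum>i\<in>UNIV. Rm (E i) Y Z (E i) q)"
proof -
  obtain U' where U': "opn U'" "q \<in> U'" "orthonormal_frame M g U' (frame_at M g q)"
    using frame_at[OF open_points[OF U]] .
  define W where "W = U \<inter> U'"
  have W: "opn W" "q \<in> W" "W \<subseteq> U" "W \<subseteq> U'" using U U' by (auto simp: W_def)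
  note YZ = vf_subset[OF Y W(3)] vf_subset[OF Z W(3)]
  have "(\<Sum>i\<in>UNIV. Rm (frame_at M g q i) Y Z (frame_at M g q i) q) = (\<Sum>i\<in>UNIV. Rm (E i) Y Z (E i) q)"
    unfolding Rm_def
    by (rule trace_frame_indep[OF W(1,2) frame_subset[OF E W(3)] frame_subset[OF U'(3) W(4)],
          where B = "\<lambda>A B. g q (R A Y Z q) (B q)"])
      (intro tensorial_R tensorial_g W YZ vf_tangent[OF _ W(2)] R_vf, assumption?)+
  then show ?thesis by (simp add: ricci_def Rm_def)
qed

text \<open>Contraction commutes with covariant differentiation, because the terms that
  differentiate the frame add up to zero by \<open>trace_deriv_zero\<close>.\<close>

lemma cov_deriv2_ricci:
  assumes U: "opn U" and q: "q \<in> U" and E: "orthonormal_frame M g U E"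
    and V: "V \<in> VF U" and Y: "Y \<in> VF U" and Z: "Z \<in> VF U"
  shows "cov_deriv2 D (ricci M g D) V Y Z q = (\<Sum>k\<in>UNIV. dRm V (E k) Y Z (E k) q)"
proof -
  note vE = frameD(1)[OF E]
  note vf = V Y Z vE D_vf[OF U]
  have "V q (ricci M g D Y Z) = V q (\<lambda>r. \<Sum>k\<in>UNIV. Rm (E k) Y Z (E k) r)"
    by (intro der_cong[OF U V q] ricci_frame[OF U _ E Y Z])
  also have "\<dots> = (\<Sum>k\<in>UNIV. V q (Rm (E k) Y Z (E k)))"
    by (intro der_sum[OF U V q] Rm_smooth U vf)
  finally have 1: "V q (ricci M g D Y Z) = \<dots>" .
  have "(\<Sum>k\<in>UNIV. Rm (D V (E k)) Y Z (E k) q + Rm (E k) Y Z (D V (E k)) q) = 0"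
    unfolding Rm_def
    by (rule trace_deriv_zero[OF U q E V, where B = "\<lambda>A B. g q (R A Y Z q) (B q)"])
      (intro tensorial_R tensorial_g U q Y Z vf_tangent[OF _ q] R_vf, assumption?)+
  then show ?thesis
    unfolding cov_deriv2_def dRm_def 1
    by (simp add: ricci_frame[OF U q E] vf sum_subtractf sum.distrib)
qed

text \<open>The symmetry of the Ricci tensor is assumed because the soliton equation provides it; this
  avoids the first Bianchi identity.\<close>

lemma contracted_bianchi:
  assumes U: "opn U" and q: "q \<in> U" and E: "orthonormal_frame M g U E" and X: "X \<in> VF U"
    and sym: "\<And>Y Z r. Y \<in> VF U \<Longrightarrow> Z \<in> VF U \<Longrightarrow> r \<in> U \<Longrightarrow> ricci M g D Y Z r = ricci M g D Z Y r"
  shows "(\<Sum>i\<in>UNIV. cov_deriv2 D (ricci M g D) X (E i) (E i) q) =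
    2 * (\<Sum>i\<in>UNIV. cov_deriv2 D (ricci M g D) (E i) (E i) X q)"
proof -
  note vE = frameD(1)[OF E]
  let ?A = "\<lambda>i k. dRm (E i) (E k) X (E i) (E k) q"
  \<comment> \<open>The trace in \<open>cov_deriv2_ricci\<close> runs over the first and last slots
    of the curvature, so moving \<open>X\<close> into the first Ricci argument gives the divergence
    the shape \<open>?A i k\<close>.\<close>
  have "cov_deriv2 D (ricci M g D) (E i) (E i) X q = cov_deriv2 D (ricci M g D) (E i) X (E i) q" for i
    unfolding cov_deriv2_def
    using sym[OF D_vf[OF U vE vE] X q] sym[OF vE D_vf[OF U vE X] q]
      der_cong[OF U vE q, of "ricci M g D (E i) X" "ricci M g D X (E i)"] sym[OF vE X] by simp
  then have div: "cov_deriv2 D (ricci M g D) (E i) (E i) X q = (\<Sum>k\<in>UNIV. ?A i k)" for i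
    using cov_deriv2_ricci[OF U q E vE X vE] by simp
  \<comment> \<open>The second Bianchi identity for \<open>X\<close>, \<open>E k\<close>,
    \<open>E i\<close>. The skew symmetries turn the two other terms into the summand of the
    divergence and the same summand with \<open>i\<close> and \<open>k\<close> exchanged, which is
    the source of the factor 2.\<close>
  have "dRm X (E k) (E i) (E i) (E k) q = ?A i k + ?A k i" for i k
    using dRm_bianchi[OF U X vE vE vE vE q, of k i i k] dRm_swap12[OF U vE vE X vE vE q, of i k i k]
      dRm_swap34[OF U vE vE X vE vE q, of k i k i] by simp
  then have "(\<Sum>i\<in>UNIV. cov_deriv2 D (ricci M g D) X (E i) (E i) q) =
      (\<Sum>i\<in>UNIV. \<Sum>k\<in>UNIV. ?A i k) + (\<Sum>i\<in>UNIV. \<Sum>k\<in>UNIV. ?A k i)"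
    using cov_deriv2_ricci[OF U q E X vE vE] by (simp add: sum.distrib)
  also have "(\<Sum>i\<in>UNIV. \<Sum>k\<in>UNIV. ?A k i) = (\<Sum>i\<in>UNIV. \<Sum>k\<in>UNIV. ?A i k)" by (rule sum.swap)
  finally show ?thesis by (simp add: div)
qed

section \<open>One-forms and their dual vector fields\<close>

definition dual_on :: "'a set \<Rightarrow> 'a tensor1 \<Rightarrow> 'a vfield \<Rightarrow> bool" where
  "dual_on U \<gamma> G \<longleftrightarrow> G \<in> VF U \<and>
     (\<forall>W X q. opn W \<and> W \<subseteq> U \<and> X \<in> VF W \<and> q \<in> W \<longrightarrow> \<gamma> X q = g q (G q) (X q))"

lemma dual_on_vf: "dual_on U \<gamma> G \<Longrightarrow> G \<in> VF U"
  unfolding dual_on_def by (rule conjunct1)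

text \<open>Test fields on smaller open sets are included because the frames chosen at nearby points
  come with domains of their own, and the duality is applied to them on intersections.\<close>

lemma dual_on_apply:
  assumes "dual_on U \<gamma> G" "opn W" "W \<subseteq> U" "X \<in> VF W" "q \<in> W"
  shows "\<gamma> X q = g q (G q) (X q)"
  by (rule assms(1)[unfolded dual_on_def, THEN conjunct2, rule_format,
        OF conjI[OF assms(2) conjI[OF assms(3) conjI[OF assms(4,5)]]]])

lemma one_form_lin:
  assumes "one_form M \<gamma>" "opn U" "X \<in> VF U" "Y \<in> VF U" "Z \<in> VF U" "smooth_fun M U a" "smooth_fun M U b"
    "\<And>p. p \<in> U \<Longrightarrow> Z p = (\<lambda>u. a p * X p u + b p * Y p u)" "q \<in> U"
  shows "\<gamma> Z q = a q * \<gamma> X q + b q * \<gamma> Y q"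
proof -
  have "\<forall>X\<in>VF U. \<forall>Y\<in>VF U. \<forall>Z\<in>VF U. \<forall>a b. smooth_fun M U a \<and> smooth_fun M U b \<and>
      (\<forall>p\<in>U. Z p = lin_comb a X b Y p) \<longrightarrow> (\<forall>p\<in>U. \<gamma> Z p = a p * \<gamma> X p + b p * \<gamma> Y p)"
    by (rule assms(1)[unfolded one_form_def, THEN spec, THEN mp, OF assms(2), THEN conjunct2])
  moreover have "smooth_fun M U a \<and> smooth_fun M U b \<and> (\<forall>p\<in>U. Z p = lin_comb a X b Y p)"
    using assms(6-8) by (simp add: lin_comb_def)
  ultimately show ?thesis using assms(3-5,9) by blast
qed

lemma one_form_smooth: "one_form M \<gamma> \<Longrightarrow> opn U \<Longrightarrow> X \<in> VF U \<Longrightarrow> smooth_fun M U (\<gamma> X)"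
  unfolding one_form_def by blast

lemma one_form_tensorial:
  assumes "one_form M \<gamma>" shows "tensorial U q (\<lambda>X. \<gamma> X q)"
proof (rule tensorialI)
  fix W X Y a assume W: "opn W" "q \<in> W" "W \<subseteq> U" and X: "X \<in> VF W"
  note c = smooth_fun_const[OF W(1)]
  note L = one_form_lin[OF assms W(1) X]
  show "\<gamma> (\<lambda>p u. a p * X p u) q = a q * \<gamma> X q" if "smooth_fun M W a"
    using L[OF X vf_scale[OF that X] that c[of 0] _ W(2)] by simp
  assume Y: "Y \<in> VF W"
  show "\<gamma> (\<lambda>p u. X p u + Y p u) q = \<gamma> X q + \<gamma> Y q"
    using L[OF Y vf_add[OF W(1) X Y] c[of 1] c[of 1] _ W(2)] by simp
  show "\<gamma> X q = \<gamma> Y q" if "\<And>p. p \<in> W \<Longrightarrow> X p = Y p"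
    using L[OF X Y c[of 1] c[of 0] _ W(2)] that by simp
qed

lemma one_form_dual:
  assumes \<gamma>: "one_form M \<gamma>" and U: "opn U" and E: "orthonormal_frame M g U E"
  shows "dual_on U \<gamma> (\<lambda>p u. \<Sum>i\<in>UNIV. \<gamma> (E i) p * E i p u)"
  unfolding dual_on_def
proof (intro conjI allI impI)
  note vE = frameD(1)[OF E]
  show "(\<lambda>p u. \<Sum>i\<in>UNIV. \<gamma> (E i) p * E i p u) \<in> VF U"
    by (intro vf_sum U vE one_form_smooth[OF \<gamma> U])
  fix W X q assume "opn W \<and> W \<subseteq> U \<and> X \<in> VF W \<and> q \<in> W"
  then have W: "opn W" "q \<in> W" "W \<subseteq> U" and X: "X \<in> VF W" by auto
  have q: "q \<in> U" using W by blast
  have "g q (\<lambda>u. \<Sum>i\<in>UNIV. \<gamma> (E i) q * E i q u) (X q) = (\<Sum>i\<in>UNIV. \<gamma> (E i) q * g q (E i q) (X q))"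
    by (intro g_sum open_points[OF U q] vf_tangent[OF X W(2)] vf_tangent[OF vE q])
  also have "\<dots> = (\<Sum>i\<in>UNIV. g q (X q) (E i q) * \<gamma> (E i) q)"
    using g_sym[OF W(1,2) X vf_subset[OF vE W(3)]] by (intro sum.cong refl) simp
  also have "\<dots> = \<gamma> X q"
    using tensorial_expand[OF one_form_tensorial[OF \<gamma>] W(1,2) subset_refl frame_subset[OF E W(3)] X]
    by simp
  finally show "\<gamma> X q = g q (\<lambda>u. \<Sum>i\<in>UNIV. \<gamma> (E i) q * E i q u) (X q)" ..
qed

lemma one_form_differential:
  assumes f: "smooth_fun M (topspace (mtop M)) f" shows "one_form M (differential f)"
  unfolding one_form_def
proof (intro allI impI conjI ballI)
  fix U X assume U: "opn U" and X: "X \<in> VF U"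
  have "smooth_fun M U f" using smooth_fun_subset[OF f U] openin_subset[OF U] by blast
  then show "smooth_fun M U (differential f X)"
    using vf_smooth[OF X, of U f] by (simp add: differential_def[abs_def])
next
  fix U X Y Z a b q
  assume "smooth_fun M U a \<and> smooth_fun M U b \<and> (\<forall>p\<in>U. Z p = lin_comb a X b Y p)" "q \<in> U"
  then show "differential f Z q = a q * differential f X q + b q * differential f Y q"
    by (simp add: differential_def lin_comb_def)
qed

text \<open>As \<open>grad\<close> is a definite description, existence and uniqueness are both due.
  The frame combination represents the differential, and any other representative has the same
  products with the \<open>E i\<close>, hence the same expansion.\<close>

lemma grad_frame:
  assumes U: "opn U" and E: "orthonormal_frame M g U E" and q: "q \<in> U"
  shows "grad M g f q = (\<lambda>u. \<Sum>i\<in>UNIV. differential f (E i) q * E i q u)"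
  unfolding grad_def
proof (rule the_equality)
  have tq: "q \<in> topspace (mtop M)" by (rule open_points[OF U q])
  have tE: "E i q \<in> tangent_space M q" for i using vf_tangent[OF frameD(1)[OF E] q] .
  let ?v = "\<lambda>u. \<Sum>i\<in>UNIV. differential f (E i) q * E i q u"
  have "g q ?v w = w f" if w: "w \<in> tangent_space M q" for w
  proof -
    have "g q ?v w = (\<Sum>i\<in>UNIV. differential f (E i) q * g q (E i q) w)"
      by (intro g_sum tq w tE)
    also have "\<dots> = (\<Sum>i\<in>UNIV. g q w (E i q) * E i q f)"
      using g_sym_at[OF tq w tE] by (intro sum.cong refl) (simp add: differential_def)
    also have "\<dots> = w f" using frame_expand_at[OF U E q w] by metis
    finally show ?thesis .
  qed
  then show "?v \<in> tangent_space M q \<and> (\<forall>w\<in>tangent_space M q. g q ?v w = w f)"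
    using tangent_space_sum[OF tq, of UNIV "\<lambda>i. E i q", OF tE] by simp
  fix v assume v: "v \<in> tangent_space M q \<and> (\<forall>w\<in>tangent_space M q. g q v w = w f)"
  then show "v = ?v" using frame_expand_at[OF U E q, of v] tE by (simp add: differential_def)
qed

lemma grad_dual:
  assumes f: "smooth_fun M (topspace (mtop M)) f" and U: "opn U" and E: "orthonormal_frame M g U E"
  shows "dual_on U (differential f) (grad M g f)"
proof -
  note d = one_form_dual[OF one_form_differential[OF f] U E]
  have "grad M g f \<in> VF U" using grad_frame[OF U E] by (intro vf_cong[OF dual_on_vf[OF d]])
  then show ?thesis using d grad_frame[OF U E] unfolding dual_on_def by (simp add: subset_iff)
qed

text \<open>Metric compatibility makes lowering an index commute with covariant differentiation, so
  that Hess f and \<nabla>\<gamma> can be computed from dual fields.\<close>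

lemma cov_deriv1_dual:
  assumes d: "dual_on U \<gamma> G" and W: "opn W" "W \<subseteq> U" and q: "q \<in> W" and X: "X \<in> VF W" and Y: "Y \<in> VF W"
  shows "cov_deriv1 D \<gamma> X Y q = g q (D X G q) (Y q)"
proof -
  have G: "G \<in> VF W" using vf_subset[OF dual_on_vf[OF d] W(2)] .
  have "X q (\<gamma> Y) = X q (\<lambda>r. g r (G r) (Y r))"
    by (intro der_cong[OF W(1) X q] dual_on_apply[OF d W Y])
  also have "\<dots> = g q (D X G q) (Y q) + g q (G q) (D X Y q)"
    by (intro compat[OF W(1)] X G Y q)
  finally show ?thesis unfolding cov_deriv1_def
    using dual_on_apply[OF d W D_vf[OF W(1) X Y] q] by simp
qed

text \<open>One frame serves all points of \<open>U\<close>, so that the codifferential can itself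
  be differentiated in the Weitzenboeck formula.\<close>

lemma codiff1_dual:
  assumes d: "dual_on U \<gamma> G" and U: "opn U" and E: "orthonormal_frame M g U E" and q: "q \<in> U"
  shows "codiff1 M g D \<gamma> q = - (\<Sum>i\<in>UNIV. g q (D (E i) G q) (E i q))"
proof -
  obtain U' where U': "opn U'" "q \<in> U'" "orthonormal_frame M g U' (frame_at M g q)"
    using frame_at[OF open_points[OF U q]] .
  define W where "W = U \<inter> U'"
  have W: "opn W" "q \<in> W" "W \<subseteq> U" "W \<subseteq> U'" using U q U' by (auto simp: W_def)
  note F = frame_subset[OF U'(3) W(4)]
  have G: "G \<in> VF W" using vf_subset[OF dual_on_vf[OF d] W(3)] .
  have "(\<Sum>i\<in>UNIV. g q (D (frame_at M g q i) G q) (frame_at M g q i q)) =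
      (\<Sum>i\<in>UNIV. g q (D (E i) G q) (E i q))"
    by (rule trace_frame_indep[OF W(1,2) frame_subset[OF E W(3)] F,
          where B = "\<lambda>A B. g q (D A G q) (B q)"])
      (intro tensorial_D tensorial_g W G vf_tangent[OF _ W(2)] D_vf, assumption?)+
  then show ?thesis unfolding codiff1_def
    using cov_deriv1_dual[OF d W(1,3,2) frameD(1)[OF F] frameD(1)[OF F]] by simp
qed

section \<open>Second covariant derivatives, the Bochner and Weitzenboeck formulas\<close>

definition nabla2 :: "'a vfield \<Rightarrow> 'a vfield \<Rightarrow> 'a vfield \<Rightarrow> 'a vfield" where
  "nabla2 X Y G = (\<lambda>p u. D X (D Y G) p u - D (D X Y) G p u)"

lemma nabla2_vf: "opn U \<Longrightarrow> X \<in> VF U \<Longrightarrow> Y \<in> VF U \<Longrightarrow> G \<in> VF U \<Longrightarrow> nabla2 X Y G \<in> VF U"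
  unfolding nabla2_def by (intro vf_diff D_vf)

lemma g_nabla2:
  assumes U: "opn U" and "X \<in> VF U" "Y \<in> VF U" "G \<in> VF U" "Z \<in> VF U" "q \<in> U"
  shows "g q (nabla2 X Y G q) (Z q) = g q (D X (D Y G) q) (Z q) - g q (D (D X Y) G q) (Z q)"
  unfolding nabla2_def using assms
  by (intro g_diff1 open_points[OF U assms(6)] vf_tangent[OF _ assms(6)] D_vf)

text \<open>The term with \<open>nabla2\<close> is the covariant derivative of the bilinear form
  sending \<open>Y\<close> and \<open>Z\<close> to the product of \<open>D Y G\<close> and
  \<open>Z\<close>. The other two summands are those in which an argument is differentiated; summed
  over a frame with \<open>Y = Z\<close> they vanish by \<open>trace_deriv_zero\<close>.\<close>

lemma g_nabla2_deriv:
  assumes U: "opn U" and "X \<in> VF U" "Y \<in> VF U" "G \<in> VF U" "Z \<in> VF U" "q \<in> U"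
  shows "X q (\<lambda>r. g r (D Y G r) (Z r)) =
    g q (nabla2 X Y G q) (Z q) + g q (D (D X Y) G q) (Z q) + g q (D Y G q) (D X Z q)"
  using compat[OF U assms(2) D_vf[OF U assms(3,4)] assms(5,6)] g_nabla2[OF assms] by simp

text \<open>Vanishing torsion combines the two correction terms of \<open>nabla2\<close> into
  \<open>D (br X Y) G\<close>, the bracket term of the curvature.\<close>

lemma ricci_identity:
  assumes U: "opn U" and "X \<in> VF U" "Y \<in> VF U" "G \<in> VF U" "Z \<in> VF U" "q \<in> U"
  shows "g q (nabla2 X Y G q) (Z q) - g q (nabla2 Y X G q) (Z q) = Rm X Y G Z q"
proof -
  note vf = assms(2-5) D_vf[OF U] br_vf[OF U] vf_diff[OF U]
  have tq: "q \<in> topspace (mtop M)" by (rule open_points[OF U assms(6)])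
  note tg = vf_tangent[OF _ assms(6)]
  have "D (br X Y) G q = D (\<lambda>p u. D X Y p u - D Y X p u) G q"
    by (intro D_cong[OF U]) (simp_all add: vf assms torsion[OF U])
  then have "D (br X Y) G q = (\<lambda>u. D (D X Y) G q u - D (D Y X) G q u)"
    using D_diff1[OF U] vf assms(6) by simp
  then have "g q (D (br X Y) G q) (Z q) = g q (D (D X Y) G q) (Z q) - g q (D (D Y X) G q) (Z q)"
    by (simp add: g_diff1[OF tq] tg vf)
  moreover have "Rm X Y G Z q = g q (D X (D Y G) q) (Z q) - g q (D Y (D X G) q) (Z q)
      - g q (D (br X Y) G q) (Z q)"
    unfolding Rm_def curvature_def by (simp add: g_diff1[OF tq] tangent_diff[OF tq] tg vf)
  ultimately show ?thesis using g_nabla2[OF assms] g_nabla2[OF U assms(3,2,4-6)] by simp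
qed

text \<open>On the left is the Hessian of the product of \<open>G\<close> and \<open>F\<close>,
  evaluated on the pair (X, X), so that the sum over a frame is its Laplacian. The correction by
  \<open>D X X\<close> on the left matches those inside \<open>nabla2\<close> on the right.\<close>

lemma bochner:
  assumes U: "opn U" and X: "X \<in> VF U" and G: "G \<in> VF U" and F: "F \<in> VF U" and q: "q \<in> U"
  shows "X q (\<lambda>r. X r (\<lambda>s. g s (G s) (F s))) - D X X q (\<lambda>s. g s (G s) (F s)) =
    g q (nabla2 X X G q) (F q) + 2 * g q (D X F q) (D X G q) + g q (nabla2 X X F q) (G q)"
proof -
  note vf = X G F D_vf[OF U]
  have "X q (\<lambda>r. X r (\<lambda>s. g s (G s) (F s))) = X q (\<lambda>r. g r (D X G r) (F r) + g r (D X F r) (G r))"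
    using g_sym[OF U _ G D_vf[OF U X F]] compat[OF U X G F] by (intro der_cong[OF U X q]) simp
  also have "\<dots> = X q (\<lambda>r. g r (D X G r) (F r)) + X q (\<lambda>r. g r (D X F r) (G r))"
    by (intro der_add[OF U X q] g_smooth U vf)
  finally have "X q (\<lambda>r. X r (\<lambda>s. g s (G s) (F s))) = \<dots>" .
  moreover have "D X X q (\<lambda>s. g s (G s) (F s)) = g q (D (D X X) G q) (F q) + g q (D (D X X) F q) (G q)"
    using compat[OF U D_vf[OF U X X] G F q] g_sym[OF U q G, of "D (D X X) F"] vf by simp
  ultimately show ?thesis
    using g_nabla2_deriv[OF U X X G F q] g_nabla2_deriv[OF U X X F G q]
      g_sym[OF U q D_vf[OF U X F] D_vf[OF U X G]] by simp
qed

lemma ext_deriv1_dual: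
  assumes d: "dual_on U \<gamma> G" and U: "opn U" and X: "X \<in> VF U" and Y: "Y \<in> VF U" and q: "q \<in> U"
  shows "ext_deriv1 M \<gamma> X Y q = g q (D X G q) (Y q) - g q (D Y G q) (X q)"
proof -
  note vf = X Y D_vf[OF U] br_vf[OF U]
  have tq: "q \<in> topspace (mtop M)" by (rule open_points[OF U q])
  note D = dual_on_apply[OF d U subset_refl _ q]
  have "g q (G q) (br X Y q) = g q (G q) (D X Y q) - g q (G q) (D Y X q)"
    by (simp add: torsion[OF U] g_diff2[OF tq] vf_tangent[OF _ q] vf dual_on_vf[OF d] q)
  then show ?thesis
    using cov_deriv1_dual[OF d U subset_refl q X Y] cov_deriv1_dual[OF d U subset_refl q Y X]
      D[OF br_vf[OF U X Y]] D[OF D_vf[OF U X Y]] D[OF D_vf[OF U Y X]]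
    unfolding ext_deriv1_def cov_deriv1_def by simp
qed

text \<open>The part d \<delta> supplies second derivatives in the order (X, E_i), the part \<delta>
  d those in the order (E_i, X) together with the trace over (E_i, E_i). The Ricci identity
  evaluates the mixed difference. The frame is \<open>frame_at M g p\<close> itself because
  \<open>codiff2\<close> at \<open>p\<close> unfolds to it.\<close>

lemma weitzenboeck:
  assumes d: "dual_on U \<gamma> G" and U: "opn U" and E: "orthonormal_frame M g U (frame_at M g p)"
    and X: "X \<in> VF U" and p: "p \<in> U"
  shows "laplace_form M g D \<gamma> X p =
    (\<Sum>i\<in>UNIV. g p (nabla2 (frame_at M g p i) (frame_at M g p i) G p) (X p)) - ricci M g D X G p"
proof -
  let ?E = "frame_at M g p"
  note vE = frameD(1)[OF E] and G = dual_on_vf[OF d]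
  note vf = X G vE D_vf[OF U]
  have s: "smooth_fun M U (\<lambda>r. g r (D A G r) (B r))" if "A \<in> VF U" "B \<in> VF U" for A B
    by (intro g_smooth U vf that)
  \<comment> \<open>At points other than \<open>p\<close> the codifferential is defined with other
    frames, so it is rewritten in this one before being differentiated.\<close>
  have "X p (codiff1 M g D \<gamma>) = X p (\<lambda>r. - (\<Sum>i\<in>UNIV. g r (D (?E i) G r) (?E i r)))"
    by (intro der_cong[OF U X p] codiff1_dual[OF d U E])
  also have "\<dots> = - (\<Sum>i\<in>UNIV. X p (\<lambda>r. g r (D (?E i) G r) (?E i r)))"
    by (subst der_minus[OF U X p], intro smooth_fun_sum U s vE, subst der_sum[OF U X p], intro s vE)
      (rule refl)
  also have "(\<Sum>i\<in>UNIV. X p (\<lambda>r. g r (D (?E i) G r) (?E i r))) =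
      (\<Sum>i\<in>UNIV. g p (nabla2 X (?E i) G p) (?E i p)) +
      (\<Sum>i\<in>UNIV. g p (D (D X (?E i)) G p) (?E i p) + g p (D (?E i) G p) (D X (?E i) p))"
    by (simp add: g_nabla2_deriv[OF U X vE G vE p] sum.distrib)
  also have "(\<Sum>i\<in>UNIV. g p (D (D X (?E i)) G p) (?E i p) + g p (D (?E i) G p) (D X (?E i) p)) = 0"
    by (rule trace_deriv_zero[OF U p E X, where B = "\<lambda>A B. g p (D A G p) (B p)"])
      (intro tensorial_D tensorial_g U p G vf_tangent[OF _ p] D_vf, assumption?)+
  finally have 1: "differential (codiff1 M g D \<gamma>) X p = - (\<Sum>i\<in>UNIV. g p (nabla2 X (?E i) G p) (?E i p))"
    by (simp add: differential_def)
  have "cov_deriv2 D (ext_deriv1 M \<gamma>) (?E i) (?E i) X p =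
      g p (nabla2 (?E i) (?E i) G p) (X p) - g p (nabla2 (?E i) X G p) (?E i p)" for i
  proof -
    have "?E i p (ext_deriv1 M \<gamma> (?E i) X) =
        ?E i p (\<lambda>r. g r (D (?E i) G r) (X r) - g r (D X G r) (?E i r))"
      by (intro der_cong[OF U vE p] ext_deriv1_dual[OF d U vE X])
    also have "\<dots> = ?E i p (\<lambda>r. g r (D (?E i) G r) (X r)) - ?E i p (\<lambda>r. g r (D X G r) (?E i r))"
      by (intro der_diff[OF U vE p] s vf)
    finally show ?thesis unfolding cov_deriv2_def
      by (simp add: ext_deriv1_dual[OF d U _ _ p] vf g_nabla2_deriv[OF U _ _ G _ p])
  qed
  then have 2: "codiff2 M g D (ext_deriv1 M \<gamma>) X p =
      - (\<Sum>i\<in>UNIV. g p (nabla2 (?E i) (?E i) G p) (X p)) + (\<Sum>i\<in>UNIV. g p (nabla2 (?E i) X G p) (?E i p))"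
    unfolding codiff2_def Let_def by (simp add: sum_subtractf)
  have "ricci M g D X G p = (\<Sum>i\<in>UNIV. g p (nabla2 (?E i) X G p) (?E i p)) -
      (\<Sum>i\<in>UNIV. g p (nabla2 X (?E i) G p) (?E i p))"
    unfolding ricci_frame[OF U p E X G] sum_subtractf[symmetric]
    using ricci_identity[OF U vE X G vE p] by simp
  then show ?thesis unfolding laplace_form_def 1 2 by simp
qed

end


section \<open>Gradient solitons\<close>

locale soliton_loc = levi_civita_loc M g D
  for M :: "('a, 'n::finite) manifold" and g D +
  fixes f :: "'a \<Rightarrow> real" and lam \<mu> :: real and U E
  assumes soliton: "gradient_eta_ricci_soliton M g D f lam \<mu>"
    and U: "opn U" and E: "orthonormal_frame M g U E"
begin

abbreviation \<xi> :: "'a vfield" where "\<xi> \<equiv> grad M g f"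

lemma frame_vf: "E i \<in> VF U" by (rule frameD(1)[OF E])

lemma f_smooth: "smooth_fun M (topspace (mtop M)) f"
  using soliton unfolding gradient_eta_ricci_soliton_def by blast

lemma f_dual: "dual_on U (differential f) \<xi>" by (rule grad_dual[OF f_smooth U E])

lemma grad_vf: "\<xi> \<in> VF U" by (rule dual_on_vf[OF f_dual])

lemma f_deriv: "X \<in> VF U \<Longrightarrow> q \<in> U \<Longrightarrow> X q f = g q (\<xi> q) (X q)"
  using dual_on_apply[OF f_dual U subset_refl] by (simp add: differential_def)

text \<open>The exterior derivative of \<open>differential f\<close> vanishes by the very definition
  of the bracket. Read through the dual field this is the symmetry of the Hessian.\<close>

lemma hess_sym:
  assumes X: "X \<in> VF U" and Y: "Y \<in> VF U" and q: "q \<in> U"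
  shows "g q (D X \<xi> q) (Y q) = g q (D Y \<xi> q) (X q)"
proof -
  have "smooth_fun M U f" using smooth_fun_subset[OF f_smooth U] openin_subset[OF U] by blast
  then have "ext_deriv1 M (differential f) X Y q = 0"
    unfolding ext_deriv1_def differential_def[abs_def] by (simp add: br_apply[OF q])
  then show ?thesis using ext_deriv1_dual[OF f_dual U X Y q] by simp
qed

text \<open>The Lie derivative of the metric along \<xi> is twice the Hessian, so the soliton
  equation can be solved for the Ricci tensor on all of \<open>U\<close> and then
  differentiated.\<close>

lemma ricci_eq:
  assumes X: "X \<in> VF U" and Y: "Y \<in> VF U" and q: "q \<in> U"
  shows "ricci M g D X Y q =
    - (g q (D X \<xi> q) (Y q) + lam * g q (X q) (Y q) + \<mu> * (g q (\<xi> q) (X q) * g q (\<xi> q) (Y q)))"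
proof -
  note vf = X Y grad_vf D_vf[OF U]
  have tq: "q \<in> topspace (mtop M)" by (rule open_points[OF U q])
  have "lie_derivative_metric M g \<xi> X Y q = g q (D X \<xi> q) (Y q) + g q (X q) (D Y \<xi> q)"
    unfolding lie_derivative_metric_def
    by (simp add: compat[OF U] torsion[OF U] g_diff1[OF tq] g_diff2[OF tq] vf q vf_tangent[OF _ q])
  also have "\<dots> = 2 * g q (D X \<xi> q) (Y q)"
    using hess_sym[OF X Y q] g_sym[OF U q X, of "D Y \<xi>"] vf by simp
  finally have 1: "lie_derivative_metric M g \<xi> X Y q = \<dots>" .
  have "lie_derivative_metric M g \<xi> X Y q + 2 * ricci M g D X Y q
      + 2 * lam * g q (X q) (Y q) + 2 * \<mu> * (differential f X q * differential f Y q) = 0"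
    using soliton X Y q U unfolding gradient_eta_ricci_soliton_def eta_ricci_soliton_def by blast
  then show ?thesis unfolding 1 using f_deriv[OF X q] f_deriv[OF Y q] by (simp add: differential_def)
qed

lemma ricci_sym: "X \<in> VF U \<Longrightarrow> Y \<in> VF U \<Longrightarrow> q \<in> U \<Longrightarrow> ricci M g D X Y q = ricci M g D Y X q"
  using hess_sym[of X Y q] g_sym[OF U, of q X Y] by (simp add: ricci_eq)

text \<open>The metric is parallel, so the derivative of the \<open>lam\<close> term is zero by
  \<open>compat\<close>. The \<mu> term contributes one summand for each factor of the
  product.\<close>

lemma cov_deriv2_ricci_eq:
  assumes V: "V \<in> VF U" and Y: "Y \<in> VF U" and Z: "Z \<in> VF U" and q: "q \<in> U"
  shows "cov_deriv2 D (ricci M g D) V Y Z q = - (g q (nabla2 V Y \<xi> q) (Z q) +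
    \<mu> * (g q (D V \<xi> q) (Y q) * g q (\<xi> q) (Z q) + g q (\<xi> q) (Y q) * g q (D V \<xi> q) (Z q)))"
proof -
  note vf = V Y Z grad_vf D_vf[OF U]
  let ?y = "\<lambda>r. g r (\<xi> r) (Y r)" and ?z = "\<lambda>r. g r (\<xi> r) (Z r)"
  have s: "smooth_fun M U (\<lambda>r. g r (A r) (B r))" if "A \<in> VF U" "B \<in> VF U" for A B
    by (intro g_smooth U that)
  have "V q (ricci M g D Y Z) = V q (\<lambda>r. - (g r (D Y \<xi> r) (Z r) + lam * g r (Y r) (Z r) + \<mu> * (?y r * ?z r)))"
    by (intro der_cong[OF U V q] ricci_eq vf)
  also have "\<dots> = - (V q (\<lambda>r. g r (D Y \<xi> r) (Z r)) + lam * V q (\<lambda>r. g r (Y r) (Z r)) +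
      \<mu> * (?y q * V q ?z + V q ?y * ?z q))"
    by (simp add: der_minus[OF U V q] der_add[OF U V q] der_cmult[OF U V q] der_mult[OF U V q]
        der_diff[OF U V q] smooth_fun_minus smooth_fun_diff
        smooth_fun_add smooth_fun_mult smooth_fun_const[OF U] s vf)
  finally show ?thesis unfolding cov_deriv2_def
    using ricci_eq[OF D_vf[OF U V Y] Z q] ricci_eq[OF Y D_vf[OF U V Z] q]
      g_nabla2_deriv[OF U V Y grad_vf Z q] compat[OF U V Y Z q] compat[OF U V grad_vf Y q] compat[OF U V grad_vf Z q]
    by (simp add: algebra_simps)
qed

lemma g_sum_frame:
  assumes "X \<in> VF U" "Y \<in> VF U" "q \<in> U"
  shows "(\<Sum>i\<in>UNIV. g q (X q) (E i q) * g q (Y q) (E i q)) = g q (X q) (Y q)"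
  using parseval[OF U E assms(3) vf_tangent[OF assms(1,3)] vf_tangent[OF assms(2,3)]]
    g_sym[OF U assms(3,2) frame_vf] by simp

text \<open>The divergence of the soliton equation minus half of the differential of its trace, times 2.\<close>

lemma soliton_divergence:
  assumes G: "G \<in> VF U" and q: "q \<in> U"
  shows "(\<Sum>i\<in>UNIV. g q (nabla2 (E i) (E i) \<xi> q) (G q)) + ricci M g D \<xi> G q
    + 2 * \<mu> * (\<Sum>i\<in>UNIV. g q (D (E i) \<xi> q) (E i q)) * g q (\<xi> q) (G q) = 0"
proof -
  note vf = G frame_vf grad_vf D_vf[OF U]
  let ?a = "\<Sum>i\<in>UNIV. g q (nabla2 (E i) (E i) \<xi> q) (G q)"
  let ?t = "\<Sum>i\<in>UNIV. g q (nabla2 G (E i) \<xi> q) (E i q)"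
  let ?l = "\<Sum>i\<in>UNIV. g q (D (E i) \<xi> q) (E i q)"
  let ?b = "g q (D G \<xi> q) (\<xi> q)"
  \<comment> \<open>The Hessian is symmetric at every point of \<open>U\<close>, hence its covariant
    derivative is symmetric in the same two arguments.\<close>
  have sym: "g q (nabla2 V Y \<xi> q) (Z q) = g q (nabla2 V Z \<xi> q) (Y q)"
    if "V \<in> VF U" "Y \<in> VF U" "Z \<in> VF U" for V Y Z
  proof -
    have "V q (\<lambda>r. g r (D Y \<xi> r) (Z r)) = V q (\<lambda>r. g r (D Z \<xi> r) (Y r))"
      by (intro der_cong[OF U that(1) q] hess_sym that)
    then show ?thesis
      using g_nabla2_deriv[OF U that(1,2) grad_vf that(3) q] g_nabla2_deriv[OF U that(1,3) grad_vf that(2) q]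
        hess_sym[of "D V Y" Z q] hess_sym[of "D V Z" Y q] that vf q by simp
  qed
  have "?a = (\<Sum>i\<in>UNIV. g q (nabla2 (E i) G \<xi> q) (E i q))" using sym vf by simp
  \<comment> \<open>Commuting the two derivatives of \<xi> produces the Ricci term;
    \<open>?t\<close> is the differential of \<Delta>f along \<open>G\<close>.\<close>
  also have "\<dots> = ?t + ricci M g D G \<xi> q"
    unfolding ricci_frame[OF U q E G grad_vf] sum.distrib[symmetric]
    using ricci_identity[OF U frame_vf G grad_vf frame_vf q] by (intro sum.cong refl) (simp add: algebra_simps)
  finally have 1: "?a = ?t + ricci M g D \<xi> G q" using ricci_sym[OF G grad_vf q] by simp
  have "(\<Sum>i\<in>UNIV. g q (\<xi> q) (E i q) * g q (D (E i) \<xi> q) (G q)) = ?b"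
    using g_sum_frame[OF grad_vf D_vf[OF U G grad_vf] q] g_sym[OF U q grad_vf D_vf[OF U G grad_vf]] hess_sym[OF frame_vf G q] by simp
  then have 2: "(\<Sum>i\<in>UNIV. cov_deriv2 D (ricci M g D) (E i) (E i) G q) =
      - (?a + \<mu> * (?l * g q (\<xi> q) (G q) + ?b))"
    using vf q
    by (simp only: cov_deriv2_ricci_eq sum_negf sum.distrib sum_distrib_left[symmetric]
        sum_distrib_right[symmetric])
  have "(\<Sum>i\<in>UNIV. g q (D G \<xi> q) (E i q) * g q (\<xi> q) (E i q)) = ?b"
    using g_sum_frame[OF D_vf[OF U G grad_vf] grad_vf q] .
  then have 3: "(\<Sum>i\<in>UNIV. cov_deriv2 D (ricci M g D) G (E i) (E i) q) = - (?t + 2 * \<mu> * ?b)"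
    using vf q
    by (simp add: cov_deriv2_ricci_eq sum.distrib sum_negf sum_subtractf mult.commute[of "g q (\<xi> q) (E _ q)"]
        flip: sum_distrib_left)
  \<comment> \<open>The trace in \<open>3\<close> contains \<open>?b\<close> twice, the divergence
    in \<open>2\<close> only once. Bianchi doubles the divergence, so \<open>?b\<close> cancels and
    just \<open>?l\<close> survives with \<mu>.\<close>
  have "- (?t + 2 * \<mu> * ?b) = 2 * (- (?a + \<mu> * (?l * g q (\<xi> q) (G q) + ?b)))"
    using contracted_bianchi[OF U q E G ricci_sym] unfolding 2 3 .
  with 1 show ?thesis by (simp add: algebra_simps)
qed

end

theorem theorem3p11:
  fixes M :: "('a, 'n::finite) manifold"
    and g :: "'a metric" and D :: "'a connection"
    and f :: "'a \<Rightarrow> real" and lam \<mu> :: real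
    and \<gamma> :: "'a tensor1" and p :: 'a
  assumes "smooth_manifold M" and "CARD('n) > 2"
    and "riemannian_metric M g" and "levi_civita_connection M g D"
    and "gradient_eta_ricci_soliton M g D f lam \<mu>"
    and "one_form M \<gamma>"
    and "p \<in> topspace (mtop M)"
  shows "1 / 2 * laplace_fun M g D (inner1 M g (differential f) \<gamma>) p =
         inner2 M g (Hess D f) (cov_deriv1 D \<gamma>) p
         - \<mu> * laplace_fun M g D f p * inner1 M g (differential f) \<gamma> p
         + 1 / 2 * inner1 M g (differential f) (laplace_form M g D \<gamma>) p"
proof -
  interpret levi_civita_loc M g D by unfold_locales (fact assms)+
  obtain U where U: "opn U" and p: "p \<in> U" and fr: "orthonormal_frame M g U (frame_at M g p)"
    using frame_at[OF assms(7)] .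
  define E where "E = frame_at M g p"
  have E: "orthonormal_frame M g U E" using fr by (simp add: E_def)
  interpret soliton_loc M g D f lam \<mu> U E
    by unfold_locales (fact assms(5) U E)+
  define G where "G = (\<lambda>q u. \<Sum>i\<in>UNIV. \<gamma> (E i) q * E i q u)"
  have d: "dual_on U \<gamma> G" unfolding G_def by (rule one_form_dual[OF assms(6) U E])
  have G: "G \<in> VF U" by (rule dual_on_vf[OF d])
  note vf = G grad_vf frame_vf D_vf[OF U] nabla2_vf[OF U]
  let ?h = "\<lambda>q. g q (G q) (\<xi> q)"
  \<comment> \<open>The inner product is differentiated twice, so a formula at all points near
    \<open>p\<close> is needed. There \<open>inner1\<close> uses the frame chosen at
    \<open>q\<close>, and Parseval in that frame eliminates it.\<close>
  have inner: "inner1 M g (differential f) \<gamma> q = ?h q" if q: "q \<in> U" for q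
  proof -
    obtain U' where U': "opn U'" "q \<in> U'" "orthonormal_frame M g U' (frame_at M g q)"
      using frame_at[OF open_points[OF U q]] .
    define W where "W = U \<inter> U'"
    have W: "opn W" "q \<in> W" "W \<subseteq> U" "W \<subseteq> U'" using U q U' by (auto simp: W_def)
    note F = frame_subset[OF U'(3) W(4)]
    have "inner1 M g (differential f) \<gamma> q =
        (\<Sum>i\<in>UNIV. g q (\<xi> q) (frame_at M g q i q) * g q (G q) (frame_at M g q i q))"
      unfolding inner1_def Let_def
      using dual_on_apply[OF f_dual W(1,3) frameD(1)[OF F] W(2)] dual_on_apply[OF d W(1,3) frameD(1)[OF F] W(2)]
      by simp
    also have "\<dots> = (\<Sum>i\<in>UNIV. g q (G q) (frame_at M g q i q) * g q (frame_at M g q i q) (\<xi> q))"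
      using g_sym[OF W(1,2) vf_subset[OF grad_vf W(3)] frameD(1)[OF F]] by (simp add: mult.commute)
    also have "\<dots> = ?h q"
      using parseval[OF W(1) F W(2) vf_tangent[OF G q] vf_tangent[OF grad_vf q]] by simp
    finally show ?thesis .
  qed
  have "laplace_fun M g D (inner1 M g (differential f) \<gamma>) p =
      (\<Sum>i\<in>UNIV. E i p (\<lambda>r. E i r (inner1 M g (differential f) \<gamma>)) - D (E i) (E i) p (inner1 M g (differential f) \<gamma>))"
    unfolding laplace_fun_def codiff1_def cov_deriv1_def E_def Let_def by (simp add: differential_def[abs_def])
  also have "\<dots> = (\<Sum>i\<in>UNIV. E i p (\<lambda>r. E i r ?h) - D (E i) (E i) p ?h)"
  proof -
    have "X q (inner1 M g (differential f) \<gamma>) = X q ?h" if "X \<in> VF U" "q \<in> U" for X q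
      by (rule der_cong[OF U that inner])
    then have "E i p (\<lambda>r. E i r (inner1 M g (differential f) \<gamma>)) = E i p (\<lambda>r. E i r ?h)"
      "D (E i) (E i) p (inner1 M g (differential f) \<gamma>) = D (E i) (E i) p ?h" for i
      using vf p by (auto intro: der_cong[OF U frame_vf p])
    then show ?thesis by simp
  qed
  also have "\<dots> = (\<Sum>i\<in>UNIV. g p (nabla2 (E i) (E i) G p) (\<xi> p))
      + 2 * (\<Sum>i\<in>UNIV. g p (D (E i) \<xi> p) (D (E i) G p)) + (\<Sum>i\<in>UNIV. g p (nabla2 (E i) (E i) \<xi> p) (G p))"
    by (simp add: bochner[OF U frame_vf G grad_vf p] sum.distrib sum_distrib_left)
  finally have lhs: "laplace_fun M g D (inner1 M g (differential f) \<gamma>) p = \<dots>" .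
  have "inner2 M g (Hess D f) (cov_deriv1 D \<gamma>) p =
      (\<Sum>i\<in>UNIV. \<Sum>j\<in>UNIV. g p (D (E i) \<xi> p) (E j p) * g p (D (E i) G p) (E j p))"
    unfolding inner2_def Hess_def E_def[symmetric] Let_def
    using cov_deriv1_dual[OF d U subset_refl p frame_vf frame_vf] cov_deriv1_dual[OF f_dual U subset_refl p frame_vf frame_vf] by simp
  also have "\<dots> = (\<Sum>i\<in>UNIV. g p (D (E i) \<xi> p) (D (E i) G p))"
    using g_sum_frame vf p by simp
  finally have hs: "inner2 M g (Hess D f) (cov_deriv1 D \<gamma>) p = \<dots>" .
  have lf: "laplace_fun M g D f p = (\<Sum>i\<in>UNIV. g p (D (E i) \<xi> p) (E i p))"
    unfolding laplace_fun_def using codiff1_dual[OF f_dual U E p] by simp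
  have "inner1 M g (differential f) (laplace_form M g D \<gamma>) p =
      (\<Sum>j\<in>UNIV. g p (\<xi> p) (E j p) * ((\<Sum>i\<in>UNIV. g p (nabla2 (E i) (E i) G p) (E j p)) - ricci M g D (E j) G p))"
    unfolding inner1_def Let_def E_def[symmetric]
    using weitzenboeck[OF d U fr frame_vf p, folded E_def] dual_on_apply[OF f_dual U subset_refl frame_vf p] by simp
  also have "\<dots> = (\<Sum>j\<in>UNIV. \<Sum>i\<in>UNIV. g p (\<xi> p) (E j p) * g p (nabla2 (E i) (E i) G p) (E j p)) -
      (\<Sum>j\<in>UNIV. g p (\<xi> p) (E j p) * ricci M g D (E j) G p)"
    by (simp add: right_diff_distrib sum_subtractf sum_distrib_left)
  also have "(\<Sum>j\<in>UNIV. \<Sum>i\<in>UNIV. g p (\<xi> p) (E j p) * g p (nabla2 (E i) (E i) G p) (E j p)) =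
      (\<Sum>i\<in>UNIV. \<Sum>j\<in>UNIV. g p (\<xi> p) (E j p) * g p (nabla2 (E i) (E i) G p) (E j p))" by (rule sum.swap)
  also have "\<dots> = (\<Sum>i\<in>UNIV. g p (nabla2 (E i) (E i) G p) (\<xi> p))"
    by (simp add: g_sum_frame[OF grad_vf nabla2_vf[OF U frame_vf frame_vf G] p] g_sym[OF U p nabla2_vf[OF U frame_vf frame_vf G] grad_vf])
  also have "(\<Sum>j\<in>UNIV. g p (\<xi> p) (E j p) * ricci M g D (E j) G p) = ricci M g D \<xi> G p"
  proof -
    \<comment> \<open>In this form of the soliton equation \<open>X\<close> occurs only inside
      \<open>g\<close>, so expanding the first argument of \<open>ricci\<close> in the frame reduces
      to Parseval.\<close>
    have r: "ricci M g D X G p =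
        - (g p (X p) (D G \<xi> p) + lam * g p (X p) (G p) + \<mu> * g p (\<xi> p) (G p) * g p (X p) (\<xi> p))"
      if "X \<in> VF U" for X
      using ricci_eq[OF that G p] hess_sym[OF that G p] g_sym[OF U p that] vf by simp
    have "(\<Sum>j\<in>UNIV. g p (\<xi> p) (E j p) * g p (E j p) (Y p)) = g p (\<xi> p) (Y p)" if "Y \<in> VF U" for Y
      using parseval[OF U E p vf_tangent[OF grad_vf p] vf_tangent[OF that p]] by simp
    note s = this[OF D_vf[OF U G grad_vf]] this[OF G] this[OF grad_vf]
    have "g p (\<xi> p) (E j p) * ricci M g D (E j) G p = - (g p (\<xi> p) (E j p) * g p (E j p) (D G \<xi> p))
        - lam * (g p (\<xi> p) (E j p) * g p (E j p) (G p))
        - (\<mu> * g p (\<xi> p) (G p)) * (g p (\<xi> p) (E j p) * g p (E j p) (\<xi> p))" for j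
      unfolding r[OF frame_vf] by (simp add: algebra_simps)
    then show ?thesis
      by (simp add: sum_subtractf sum_negf s r[OF grad_vf] flip: sum_distrib_left)
  qed
  finally have rhs: "inner1 M g (differential f) (laplace_form M g D \<gamma>) p =
      (\<Sum>i\<in>UNIV. g p (nabla2 (E i) (E i) G p) (\<xi> p)) - ricci M g D \<xi> G p" .
  \<comment> \<open>The two sides differ by half of the trace of \<open>nabla2\<close> of \<xi>
    against \<open>G\<close> plus half of the Ricci term; \<open>soliton_divergence\<close>
    evaluates this sum as the \<mu> term.\<close>
  show ?thesis unfolding lhs hs lf rhs inner[OF p]
    using soliton_divergence[OF G p] g_sym[OF U p G grad_vf] by (simp add: algebra_simps)
qed

end
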